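(* There exists a satisfiable CHC problem $\Phi$ such that $\Phi\not\leadsto_{rs}^*\mathsf{sat}$, where $\leadsto_{rs}$ is the transition relation of the ADCL calculus with a reasonable strategy imposed. Thus, $\leadsto_{rs}$ does not terminate.
   Context: **Clauses.** $\Sigma$ is a many-sorted first-order signature containing only predicate symbols; $\mathcal{A}$ (the background theory) is a complete theory with equality over a many-sorted signature $\Sigma_{\mathcal{A}}$ disjoint from $\Sigma$; $\mathcal{V}$ is a countably infinite set of variables; $\mathsf{QF}(\mathcal{A})$ is the set of quantifier-free first-order formulas over $\Sigma_{\mathcal{A}}$. A (linear) CHC is a universally closed formula of one of the forms $\psi \Rightarrow G(\vec Y)$ (fact), $F(\vec X)\wedge\psi\Rightarrow G(\vec Y)$ (rule), $F(\vec X)\wedge \psi\Rightarrow\bot$ (query), $\psi\Rightarrow\bot$ (conditional empty clause), where $F,G\in\Sigma$, $\vec X,\vec Y$ are disjoint vectors of pairwise different variables, and $\psi\in\mathsf{QF}(\mathcal{A})$ is in negation normal form and may contain further variables. We uniformly write $\eta\wedge\psi\Rightarrow\eta'$, where $\eta$ can be $\top$ (no body atom) and $\eta'$ can be $\bot$ (no head atom). The condition is $\mathsf{cond}(\eta\wedge\psi\Rightarrow\eta')=\psi$; $\varphi|_{\psi'}$ is $\varphi$ with its condition replaced by $\psi'$. A CHC is recursive if it is a rule with $F=G$, and conjunctive if $\psi$ is a conjunction of literals. A CHC problem is a set of CHCs. **Semantics.** An $\mathcal{A}$-interpretation is a model of $\mathcal{A}$ whose carrier only contains ground terms over $\Sigma_{\mathcal{A}}$,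 extended with interpretations for $\Sigma$ and $\mathcal{V}$; as $\mathcal{A}$ is complete, $\mathcal{A}$-interpretations are regarded as differing only on $\Sigma$ and $\mathcal{V}$. $\sigma\models_{\mathcal{A}}\eta$ means that the $\mathcal{A}$-interpretation $\sigma$ satisfies $\eta$; a formula (or set of formulas) is satisfiable if some $\mathcal{A}$-interpretation satisfies it (all of its elements). The ground instances are $\mathsf{grnd}(\eta\wedge\psi\Rightarrow\eta')=\{\eta\sigma\Rightarrow\eta'\sigma\mid\sigma\models_{\mathcal{A}}\psi\}$, where $\eta\sigma$ instantiates the variables of $\eta$ according to $\sigma$. **Resolution.** For $\varphi=(\eta\wedge\psi\Rightarrow F(\vec x))$ and $\varphi'=(F(\vec y)\wedge\psi'\Rightarrow\eta')$, renamed to be variable-disjoint, with $\theta=\mathrm{mgu}(F(\vec x),F(\vec y))$, let $\mathsf{res}(\varphi,\varphi')=(\eta\wedge\psi\wedge\psi'\Rightarrow\eta')\theta$; in all other cases $\mathsf{res}(\varphi,\varphi')=(\bot\Rightarrow\bot)$. For non-empty sequences: $\mathsf{res}([\varphi_1])=\varphi_1$, $\mathsf{res}([\varphi_1,\varphi_2]::\vec\varphi)=\mathsf{res}(\mathsf{res}(\varphi_1,\varphi_2)::\vec\varphi)$, where $::$ is concatenation (single elements are identified with sequences of length 1). Notions for CHCs are lifted to sequences via $\mathsf{res}$, e.g. $\mathsf{cond}(\vec\varphi)=\mathsf{cond}(\mathsf{res}(\vec\varphi))$, $\mathsf{grnd}(\vec\varphi)=\mathsf{grnd}(\mathsf{res}(\vec\varphi))$,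 and $\vec\varphi$ is recursive if $\mathsf{res}(\vec\varphi)$ is. A refutation is a conditional empty clause with satisfiable condition (lifted to sequences in the same way). **Acceleration.** An acceleration technique is a function $\mathsf{accel}$ mapping a recursive conjunctive CHC $\varphi$ to a recursive conjunctive CHC such that $\mathsf{grnd}(\mathsf{accel}(\varphi))=\bigcup_{n\ge1}\mathsf{grnd}(\varphi^n)$, where $\varphi^n$ is the sequence of $n$ copies of $\varphi$. $\mathsf{accel}(\vec\varphi)$ means $\mathsf{accel}(\mathsf{res}(\vec\varphi))$. One assumes oracles for acceleration, for checking redundancy (defined below), and for satisfiability of $\mathsf{QF}(\mathcal{A})$-formulas. The condition of an accelerated clause may not be expressible in $\mathcal{A}$; therefore, when the rule Accelerate below is applied, one may implicitly switch to a richer theory $\mathcal{A}'$ (e.g., from linear to non-linear arithmetic). **Syntactic implicants.** For $\psi\in\mathsf{QF}(\mathcal{A})$ in negation normal form and $\sigma\models_{\mathcal{A}}\psi$ let $\mathsf{sip}(\psi,\sigma)=\bigwedge\{\ell \text{ is a literal of }\psi\mid\sigma\models_{\mathcal{A}}\ell\}$; $\mathsf{sip}(\psi)=\{\mathsf{sip}(\psi,\sigma)\mid\sigma\models_{\mathcal{A}}\psi\}$; $\mathsf{sip}(\varphi)=\{\varphi|_\psi\mid\psi\in\mathsf{sip}(\mathsf{cond}(\varphi))\}$ for CHCs $\varphi$; $\mathsf{sip}(\Pi)=\bigcup_{\varphi\in\Pi}\mathsf{sip}(\varphi)$ for sets of CHCs $\Pi$. **Redundancy.** $\varphi\sqsubseteq\pi$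 iff $\mathsf{grnd}(\varphi)\subseteq\mathsf{grnd}(\pi)$; $\varphi\sqsubset\pi$ iff $\mathsf{grnd}(\varphi)\subsetneq\mathsf{grnd}(\pi)$; for a set $\Pi$ of CHCs, $\varphi\sqsubseteq\Pi$ (resp. $\varphi\sqsubset\Pi$) iff $\varphi\sqsubseteq\pi$ (resp. $\varphi\sqsubset\pi$) for some $\pi\in\Pi$. "Redundant w.r.t. $\Pi$" means $\sqsubseteq\Pi$. **ADCL.** $\Phi$ is the original CHC problem. A state is a triple $(\Pi,[\varphi_i]_{i=1}^k,[B_i]_{i=0}^k)$ with $\Pi\supseteq\Phi$ a CHC problem, $[\varphi_i]_{i=1}^k\in\mathsf{sip}(\Pi)^*$ (the trace), and $B_i\subseteq\mathsf{sip}(\Pi)$ for each $0\le i\le k$. A clause $\varphi$ is blocked if $\varphi\sqsubseteq B_k$, and active if it is not blocked and $\mathsf{cond}([\varphi_i]_{i=1}^k::\varphi)$ is satisfiable; otherwise it is inactive. Let $\mathsf{bt}(\Pi,[\varphi_i]_{i=1}^k,[B_0,\dots,B_k])=(\Pi,[\varphi_i]_{i=1}^{k-1},[B_0,\dots,B_{k-1}\cup\{\varphi_k\}])$. The relation $\leadsto$ is given by the following rules: - Init: $\Phi\leadsto(\Phi,[],[\emptyset])$. - Step: $(\Pi,\vec\varphi,\vec B)\leadsto(\Pi,\vec\varphi::\varphi,\vec B::\emptyset)$ if $\varphi\in\mathsf{sip}(\Pi)$ is active. - Accelerate: $(\Pi,\vec\varphi::\vec\varphi^\circ,\vec B::\vec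 B^\circ)\leadsto(\Pi\cup\{\varphi\},\vec\varphi::\varphi,\vec B::\{\varphi\})$ if $\vec\varphi^\circ$ is recursive, $|\vec\varphi^\circ|=|\vec B^\circ|$, and $\mathsf{accel}(\vec\varphi^\circ)=\varphi$. - Covered: $s=(\Pi,\vec\varphi::\vec\varphi',\vec B)\leadsto\mathsf{bt}(s)$ if $\vec\varphi'\sqsubset\mathsf{sip}(\Pi)$, or $\vec\varphi'\sqsubseteq\mathsf{sip}(\Pi)$ and $|\vec\varphi'|>1$. - Backtrack: $s=(\Pi,\vec\varphi::\varphi,\vec B)\leadsto\mathsf{bt}(s)$ if all rules and queries from $\mathsf{sip}(\Pi)$ are inactive and $\varphi$ is not a query. - Refute: $(\Pi,\vec\varphi,\vec B)\leadsto\mathsf{unsat}$ if $\vec\varphi$ is a refutation. - Prove: $(\Pi,[],[B])\leadsto\mathsf{sat}$ if all facts and conditional empty clauses from $\mathsf{sip}(\Pi)$ are inactive. **Reasonable strategy.** A strategy for $\leadsto$ is reasonable if: (1) if $(\Pi,\vec\varphi,\vec B)\leadsto^+(\Pi,\vec\varphi::\vec\varphi',\vec B')$ for some $\vec\varphi'$ as in the definition of Covered, then Covered is used (so Covered is enforced only if the clause set $\Pi$ remained unchanged while $\vec\varphi'$ was constructed); (2) Accelerate is used with higher preference than Step; (3) Accelerate is only applied to the shortest recursive suffix $\vec\varphi^\circ$ of the trace such that $\mathsf{accel}(\vec\varphi^\circ)$ is not redundant w.r.t. $\mathsf{sip}(\Pi)$; (4) if the trace is empty, then Step is only applied with facts or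 conditional empty clauses. $\leadsto_{rs}$ is the relation that results from $\leadsto$ by imposing a reasonable strategy. **Bookkeeping component.** States of $\leadsto_{rs}$ are extended by a fourth component $\mathcal{L}$ mapping each element of $\mathsf{sip}(\Pi)$ to a language over $\mathsf{sip}(\Phi)$: Init sets $\mathcal{L}(\varphi)=\{\varphi\}$ for all $\varphi\in\mathsf{sip}(\Phi)$, Accelerate additionally maps the new clause $\varphi=\mathsf{accel}(\vec\varphi^\circ)$ to $\mathcal{L}(\vec\varphi^\circ)^+$ (Kleene plus, where $\mathcal{L}$ of a sequence is the concatenation of the languages of its elements), and all other rules leave $\mathcal{L}$ unchanged. No rule's applicability depends on $\mathcal{L}$. $\leadsto_{rs}^*$ is the reflexive-transitive closure of $\leadsto_{rs}$. *)

theory Defs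
  imports Main "HOL-Library.Sublist"
begin

section \<open>Syntax\<close>

text \<open>A variable is an index together with its sort.\<close>

type_synonym 's var = "nat \<times> 's"

datatype (dead 'f, vars_tm: 'v) tm =
  Var 'v | Fun 'f "('f, 'v) tm list"
  for map: rename_tm

datatype (dead 'f, dead 'r, vars_atm: 'v) atm =
  Eq "('f, 'v) tm" "('f, 'v) tm" | Rel 'r "('f, 'v) tm list"
  for map: rename_atm

text \<open>
  Quantifier-free formulas in negation normal form; the Boolean of a literal is its polarity.
  Conjunction and disjunction are n-ary, so \<open>Conj []\<close> is truth and \<open>Disj []\<close> is falsity.
\<close>

datatype (dead 'f, dead 'r, vars_qf: 'v) qf =
  Lit bool "('f, 'r, 'v) atm" | Conj "('f, 'r, 'v) qf list" | Disj "('f, 'r, 'v) qf list"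
  for map: rename_qf

text \<open>First-order formulas, which are needed only for the axioms of the background theory.\<close>

datatype ('f, 'r, 'v) fm =
  Atom "('f, 'r, 'v) atm" | Neg "('f, 'r, 'v) fm"
  | And "('f, 'r, 'v) fm" "('f, 'r, 'v) fm" | All 'v "('f, 'r, 'v) fm"

primrec free_vars :: "('f, 'r, 'v) fm \<Rightarrow> 'v set" where
  "free_vars (Atom a) = vars_atm a"
| "free_vars (Neg \<phi>) = free_vars \<phi>"
| "free_vars (And \<phi> \<psi>) = free_vars \<phi> \<union> free_vars \<psi>"
| "free_vars (All v \<phi>) = free_vars \<phi> - {v}"

section \<open>Background theories\<close>

text \<open>
  A many-sorted signature, a theory over it, and its term model, whose carriers consist of
  ground terms. Interpretations of the background signature are not varied any further, since
  the theory is complete.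
\<close>

record ('s, 'f, 'r) background =
  sorts :: "'s set"
  fun_type :: "'f \<Rightarrow> ('s list \<times> 's) option"
  rel_type :: "'r \<Rightarrow> 's list option"
  axs :: "('f, 'r, 's var) fm set"
  univ :: "'s \<Rightarrow> ('f, 's var) tm set"
  fun_int :: "'f \<Rightarrow> ('f, 's var) tm list \<Rightarrow> ('f, 's var) tm"
  rel_int :: "'r \<Rightarrow> ('f, 's var) tm list \<Rightarrow> bool"

type_synonym ('f, 's) valuation = "'s var \<Rightarrow> ('f, 's var) tm"

inductive has_sort :: "('s, 'f, 'r) background \<Rightarrow> ('f, 's var) tm \<Rightarrow> 's \<Rightarrow> bool"
  for A where
  "s \<in> sorts A \<Longrightarrow> has_sort A (Var (n, s)) s"
| "fun_type A f = Some (ss, s) \<Longrightarrow> list_all2 (has_sort A) ts ss \<Longrightarrow> has_sort A (Fun f ts) s"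

primrec wf_atm :: "('s, 'f, 'r) background \<Rightarrow> ('f, 'r, 's var) atm \<Rightarrow> bool" where
  "wf_atm A (Eq t u) = (\<exists>s. has_sort A t s \<and> has_sort A u s)"
| "wf_atm A (Rel r ts) = (\<exists>ss. rel_type A r = Some ss \<and> list_all2 (has_sort A) ts ss)"

primrec wf_qf :: "('s, 'f, 'r) background \<Rightarrow> ('f, 'r, 's var) qf \<Rightarrow> bool" where
  "wf_qf A (Lit b a) = wf_atm A a"
| "wf_qf A (Conj \<psi>s) = list_all (wf_qf A) \<psi>s"
| "wf_qf A (Disj \<psi>s) = list_all (wf_qf A) \<psi>s"

primrec wf_fm :: "('s, 'f, 'r) background \<Rightarrow> ('f, 'r, 's var) fm \<Rightarrow> bool" where
  "wf_fm A (Atom a) = wf_atm A a"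
| "wf_fm A (Neg \<phi>) = wf_fm A \<phi>"
| "wf_fm A (And \<phi> \<psi>) = (wf_fm A \<phi> \<and> wf_fm A \<psi>)"
| "wf_fm A (All v \<phi>) = (snd v \<in> sorts A \<and> wf_fm A \<phi>)"

definition sentences :: "('s, 'f, 'r) background \<Rightarrow> ('f, 'r, 's var) fm set" where
  "sentences A = {\<phi>. wf_fm A \<phi> \<and> free_vars \<phi> = {}}"

definition valuations :: "('s, 'f, 'r) background \<Rightarrow> ('f, 's) valuation set" where
  "valuations A = {\<sigma>. \<forall>n. \<forall>s\<in>sorts A. \<sigma> (n, s) \<in> univ A s}"

primrec eval ::
  "('s, 'f, 'r) background \<Rightarrow> ('f, 's) valuation \<Rightarrow> ('f, 's var) tm \<Rightarrow> ('f, 's var) tm" where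
  "eval A \<sigma> (Var v) = \<sigma> v"
| "eval A \<sigma> (Fun f ts) = fun_int A f (map (eval A \<sigma>) ts)"

primrec atm_holds ::
  "('s, 'f, 'r) background \<Rightarrow> ('f, 's) valuation \<Rightarrow> ('f, 'r, 's var) atm \<Rightarrow> bool" where
  "atm_holds A \<sigma> (Eq t u) = (eval A \<sigma> t = eval A \<sigma> u)"
| "atm_holds A \<sigma> (Rel r ts) = rel_int A r (map (eval A \<sigma>) ts)"

fun qf_holds ::
  "('s, 'f, 'r) background \<Rightarrow> ('f, 's) valuation \<Rightarrow> ('f, 'r, 's var) qf \<Rightarrow> bool" where
  "qf_holds A \<sigma> (Lit b a) = (atm_holds A \<sigma> a = b)"
| "qf_holds A \<sigma> (Conj \<psi>s) \<longleftrightarrow> (\<forall>\<psi>\<in>set \<psi>s. qf_holds A \<sigma> \<psi>)"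
| "qf_holds A \<sigma> (Disj \<psi>s) \<longleftrightarrow> (\<exists>\<psi>\<in>set \<psi>s. qf_holds A \<sigma> \<psi>)"

primrec fm_holds ::
  "('s, 'f, 'r) background \<Rightarrow> ('f, 's) valuation \<Rightarrow> ('f, 'r, 's var) fm \<Rightarrow> bool" where
  "fm_holds A \<sigma> (Atom a) = atm_holds A \<sigma> a"
| "fm_holds A \<sigma> (Neg \<phi>) = (\<not> fm_holds A \<sigma> \<phi>)"
| "fm_holds A \<sigma> (And \<phi> \<psi>) = (fm_holds A \<sigma> \<phi> \<and> fm_holds A \<sigma> \<psi>)"
| "fm_holds A \<sigma> (All v \<phi>) = (\<forall>t\<in>univ A (snd v). fm_holds A (\<sigma>(v := t)) \<phi>)"

text \<open>
  A theory is a deductively closed set of sentences, so completeness means that it contains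
  every sentence or its negation. Each element of a carrier is a ground term that denotes
  itself, so that instantiating a variable by its value does not change its meaning.
\<close>

definition is_background :: "('s, 'f, 'r) background \<Rightarrow> bool" where
  "is_background A \<longleftrightarrow>
     (\<forall>f ss s. fun_type A f = Some (ss, s) \<longrightarrow> insert s (set ss) \<subseteq> sorts A) \<and>
     (\<forall>r ss. rel_type A r = Some ss \<longrightarrow> set ss \<subseteq> sorts A) \<and>
     (\<forall>s\<in>sorts A. univ A s \<noteq> {}) \<and>
     (\<forall>s\<in>sorts A. \<forall>t\<in>univ A s.
        has_sort A t s \<and> vars_tm t = {} \<and> (\<forall>\<sigma>\<in>valuations A. eval A \<sigma> t = t)) \<and>
     (\<forall>f ss s ts. fun_type A f = Some (ss, s) \<longrightarrow> list_all2 (\<lambda>t s. t \<in> univ A s) ts ss \<longrightarrow>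
        fun_int A f ts \<in> univ A s) \<and>
     axs A \<subseteq> sentences A \<and>
     (\<forall>\<phi>\<in>sentences A. \<phi> \<in> axs A \<or> Neg \<phi> \<in> axs A) \<and>
     (\<forall>\<phi>\<in>axs A. \<forall>\<sigma>\<in>valuations A. fm_holds A \<sigma> \<phi>)"

text \<open>
  A richer theory: it may have additional symbols, but the old ones keep their meaning, so
  every sentence of the old theory is a sentence of the new one.
\<close>

definition richer :: "('s, 'f, 'r) background \<Rightarrow> ('s, 'f, 'r) background \<Rightarrow> bool" where
  "richer A' A \<longleftrightarrow>
     sorts A \<subseteq> sorts A' \<and> fun_type A \<subseteq>\<^sub>m fun_type A' \<and> rel_type A \<subseteq>\<^sub>m rel_type A' \<and>
     (\<forall>s\<in>sorts A. univ A' s = univ A s) \<and>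
     (\<forall>f ss s ts. fun_type A f = Some (ss, s) \<longrightarrow> list_all2 (\<lambda>t s. t \<in> univ A s) ts ss \<longrightarrow>
        fun_int A' f ts = fun_int A f ts) \<and>
     (\<forall>r ss ts. rel_type A r = Some ss \<longrightarrow> list_all2 (\<lambda>t s. t \<in> univ A s) ts ss \<longrightarrow>
        rel_int A' r ts = rel_int A r ts)"

section \<open>Constrained Horn clauses\<close>

text \<open>
  The body and the head are either a predicate applied to variables, or \<open>None\<close>, which stands
  for truth in the body and for falsity in the head.
\<close>

type_synonym ('p, 's) patom = "'p \<times> 's var list"

datatype ('f, 'r, 'p, 's) chc =
  CHC (body: "('p, 's) patom option") (cond: "('f, 'r, 's var) qf") (head: "('p, 's) patom option")

definition args :: "('p, 's) patom option \<Rightarrow> 's var list" where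
  "args \<eta> = (case \<eta> of None \<Rightarrow> [] | Some (F, xs) \<Rightarrow> xs)"

definition chc_vars :: "('f, 'r, 'p, 's) chc \<Rightarrow> 's var set" where
  "chc_vars \<phi> = set (args (body \<phi>)) \<union> vars_qf (cond \<phi>) \<union> set (args (head \<phi>))"

text \<open>The argument \<open>Sig\<close> declares the predicate symbols and the sorts of their arguments.\<close>

definition wf_patom ::
  "('s, 'f, 'r) background \<Rightarrow> ('p \<Rightarrow> 's list option) \<Rightarrow> ('p, 's) patom option \<Rightarrow> bool" where
  "wf_patom A Sig \<eta> \<longleftrightarrow>
     (case \<eta> of None \<Rightarrow> True
      | Some (F, xs) \<Rightarrow> Sig F = Some (map snd xs) \<and> set (map snd xs) \<subseteq> sorts A)"

definition is_chc ::
  "('s, 'f, 'r) background \<Rightarrow> ('p \<Rightarrow> 's list option) \<Rightarrow> ('f, 'r, 'p, 's) chc \<Rightarrow> bool" where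
  "is_chc A Sig \<phi> \<longleftrightarrow>
     wf_patom A Sig (body \<phi>) \<and> wf_patom A Sig (head \<phi>) \<and> wf_qf A (cond \<phi>) \<and>
     distinct (args (body \<phi>) @ args (head \<phi>))"

definition is_fact :: "('f, 'r, 'p, 's) chc \<Rightarrow> bool" where
  "is_fact \<phi> \<longleftrightarrow> body \<phi> = None \<and> head \<phi> \<noteq> None"

definition is_rule :: "('f, 'r, 'p, 's) chc \<Rightarrow> bool" where
  "is_rule \<phi> \<longleftrightarrow> body \<phi> \<noteq> None \<and> head \<phi> \<noteq> None"

definition is_query :: "('f, 'r, 'p, 's) chc \<Rightarrow> bool" where
  "is_query \<phi> \<longleftrightarrow> body \<phi> \<noteq> None \<and> head \<phi> = None"

definition is_cond_empty :: "('f, 'r, 'p, 's) chc \<Rightarrow> bool" where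
  "is_cond_empty \<phi> \<longleftrightarrow> body \<phi> = None \<and> head \<phi> = None"

definition recursive :: "('f, 'r, 'p, 's) chc \<Rightarrow> bool" where
  "recursive \<phi> \<longleftrightarrow> (\<exists>F xs ys. body \<phi> = Some (F, xs) \<and> head \<phi> = Some (F, ys))"

text \<open>A conjunction of literals is always built with \<open>Conj\<close>, even if it has a single conjunct.\<close>

definition conjunctive :: "('f, 'r, 'p, 's) chc \<Rightarrow> bool" where
  "conjunctive \<phi> \<longleftrightarrow> (\<exists>ls. cond \<phi> = Conj ls \<and> (\<forall>l\<in>set ls. \<exists>b a. l = Lit b a))"

definition patom_holds ::
  "('p \<Rightarrow> ('f, 's var) tm list \<Rightarrow> bool) \<Rightarrow> ('f, 's) valuation \<Rightarrow> ('p, 's) patom \<Rightarrow> bool" where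
  "patom_holds J \<sigma> = (\<lambda>(F, xs). J F (map \<sigma> xs))"

definition chc_holds ::
  "('s, 'f, 'r) background \<Rightarrow> ('p \<Rightarrow> ('f, 's var) tm list \<Rightarrow> bool) \<Rightarrow> ('f, 's) valuation
   \<Rightarrow> ('f, 'r, 'p, 's) chc \<Rightarrow> bool" where
  "chc_holds A J \<sigma> \<phi> \<longleftrightarrow>
     pred_option (patom_holds J \<sigma>) (body \<phi>) \<and> qf_holds A \<sigma> (cond \<phi>) \<longrightarrow>
     (\<exists>\<eta>. head \<phi> = Some \<eta> \<and> patom_holds J \<sigma> \<eta>)"

definition chc_satisfiable :: "('s, 'f, 'r) background \<Rightarrow> ('f, 'r, 'p, 's) chc set \<Rightarrow> bool" where
  "chc_satisfiable A \<Phi> \<longleftrightarrow> (\<exists>J. \<forall>\<phi>\<in>\<Phi>. \<forall>\<sigma>\<in>valuations A. chc_holds A J \<sigma> \<phi>)"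

definition cond_satisfiable :: "('s, 'f, 'r) background \<Rightarrow> ('f, 'r, 'p, 's) chc \<Rightarrow> bool" where
  "cond_satisfiable A \<phi> \<longleftrightarrow> (\<exists>\<sigma>\<in>valuations A. qf_holds A \<sigma> (cond \<phi>))"

definition grnd ::
  "('s, 'f, 'r) background \<Rightarrow> ('f, 'r, 'p, 's) chc
   \<Rightarrow> (('p \<times> ('f, 's var) tm list) option \<times> ('p \<times> ('f, 's var) tm list) option) set" where
  "grnd A \<phi> =
     {(map_option (apsnd (map \<sigma>)) (body \<phi>), map_option (apsnd (map \<sigma>)) (head \<phi>)) | \<sigma>.
        \<sigma> \<in> valuations A \<and> qf_holds A \<sigma> (cond \<phi>)}"

section \<open>Resolution\<close>

definition rename_chc :: "('s var \<Rightarrow> 's var) \<Rightarrow> ('f, 'r, 'p, 's) chc \<Rightarrow> ('f, 'r, 'p, 's) chc" where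
  "rename_chc \<rho> \<phi> =
     CHC (map_option (apsnd (map \<rho>)) (body \<phi>)) (rename_qf \<rho> (cond \<phi>))
       (map_option (apsnd (map \<rho>)) (head \<phi>))"

text \<open>The second clause is renamed apart from the first one by shifting the variable indices.\<close>

definition rename_apart ::
  "('f, 'r, 'p, 's) chc \<Rightarrow> ('f, 'r, 'p, 's) chc \<Rightarrow> ('f, 'r, 'p, 's) chc" where
  "rename_apart \<phi> \<phi>' =
     rename_chc (\<lambda>(n, s). (n + Suc (Max (insert 0 (fst ` chc_vars \<phi>))), s)) \<phi>'"

text \<open>
  The terms to be unified are applications of the same predicate to disjoint vectors of pairwise
  different variables \<open>xs\<close> and \<open>ys\<close>, so mapping each variable of \<open>ys\<close> to the corresponding
  variable of \<open>xs\<close> is a most general unifier. The two lemmas below confirm this.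
\<close>

definition mgu :: "'v list \<Rightarrow> 'v list \<Rightarrow> 'v \<Rightarrow> 'v" where
  "mgu xs ys v = (case map_of (zip ys xs) v of None \<Rightarrow> v | Some x \<Rightarrow> x)"

lemma mgu_unifies:
  assumes "length xs = length ys" "distinct ys" "set xs \<inter> set ys = {}"
  shows "map (mgu xs ys) xs = map (mgu xs ys) ys"
proof -
  have "mgu xs ys (xs ! i) = mgu xs ys (ys ! i)" if "i < length xs" for i
  proof -
    have "map_of (zip ys xs) (xs ! i) = None"
      using assms that by (metis IntI empty_iff map_of_SomeD not_None_eq nth_mem set_zip_leftD)
    moreover have "map_of (zip ys xs) (ys ! i) = Some (xs ! i)"
      using assms that by (simp add: map_of_zip_nth)
    ultimately show ?thesis by (simp add: mgu_def)
  qed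
  then show ?thesis using assms by (simp add: list_eq_iff_nth_eq)
qed

lemma mgu_most_general:
  fixes \<tau> :: "'v \<Rightarrow> ('f, 'v) tm"
  assumes "map \<tau> xs = map \<tau> ys"
  shows "\<tau> (mgu xs ys v) = \<tau> v"
proof (cases "map_of (zip ys xs) v")
  case (Some x)
  then have "(v, x) \<in> set (zip ys xs)" by (rule map_of_SomeD)
  then obtain i where "i < length ys" "i < length xs" "v = ys ! i" "x = xs ! i"
    by (auto simp: set_zip)
  then have "\<tau> x = \<tau> v" using assms by (metis nth_map)
  then show ?thesis using Some by (simp add: mgu_def)
qed (simp add: mgu_def)

text \<open>
  Conjunctions are flattened, such that the conjunction of two conjunctions of literals is again
  literally of that form.
\<close>

fun conjuncts :: "('f, 'r, 'v) qf \<Rightarrow> ('f, 'r, 'v) qf list" where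
  "conjuncts (Conj \<psi>s) = \<psi>s"
| "conjuncts \<psi> = [\<psi>]"

definition qf_and :: "('f, 'r, 'v) qf \<Rightarrow> ('f, 'r, 'v) qf \<Rightarrow> ('f, 'r, 'v) qf" where
  "qf_and \<psi> \<psi>' = Conj (conjuncts \<psi> @ conjuncts \<psi>')"

text \<open>\<open>CHC None (Disj []) None\<close> is the clause whose condition and head are falsity.\<close>

definition res :: "('f, 'r, 'p, 's) chc \<Rightarrow> ('f, 'r, 'p, 's) chc \<Rightarrow> ('f, 'r, 'p, 's) chc" where
  "res \<phi> \<phi>' =
     (let \<phi>'' = rename_apart \<phi> \<phi>' in
      case (head \<phi>, body \<phi>'') of
        (Some (F, xs), Some (G, ys)) \<Rightarrow>
          if F = G
          then rename_chc (mgu xs ys) (CHC (body \<phi>) (qf_and (cond \<phi>) (cond \<phi>'')) (head \<phi>''))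
          else CHC None (Disj []) None
      | _ \<Rightarrow> CHC None (Disj []) None)"

text \<open>Resolution of sequences is meaningful for non-empty sequences only.\<close>

fun res_seq :: "('f, 'r, 'p, 's) chc list \<Rightarrow> ('f, 'r, 'p, 's) chc" where
  "res_seq [\<phi>] = \<phi>"
| "res_seq (\<phi>1 # \<phi>2 # \<phi>s) = res_seq (res \<phi>1 \<phi>2 # \<phi>s)"

definition is_refutation :: "('s, 'f, 'r) background \<Rightarrow> ('f, 'r, 'p, 's) chc \<Rightarrow> bool" where
  "is_refutation A \<phi> \<longleftrightarrow> is_cond_empty \<phi> \<and> cond_satisfiable A \<phi>"

section \<open>Acceleration, syntactic implicants and redundancy\<close>

definition acceleration_technique ::
  "('s, 'f, 'r) background \<Rightarrow> ('p \<Rightarrow> 's list option)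
   \<Rightarrow> (('f, 'r, 'p, 's) chc \<Rightarrow> ('f, 'r, 'p, 's) chc) \<Rightarrow> bool" where
  "acceleration_technique A Sig accel \<longleftrightarrow>
     (\<forall>\<phi>. is_chc A Sig \<phi> \<and> recursive \<phi> \<and> conjunctive \<phi> \<longrightarrow>
        is_chc A Sig (accel \<phi>) \<and> recursive (accel \<phi>) \<and> conjunctive (accel \<phi>) \<and>
        grnd A (accel \<phi>) = (\<Union>n\<in>{1..}. grnd A (res_seq (replicate n \<phi>))))"

primrec literals :: "('f, 'r, 'v) qf \<Rightarrow> ('f, 'r, 'v) qf list" where
  "literals (Lit b a) = [Lit b a]"
| "literals (Conj \<psi>s) = concat (map literals \<psi>s)"
| "literals (Disj \<psi>s) = concat (map literals \<psi>s)"

text \<open>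
  The conjuncts are listed in the order of their occurrence and with their multiplicities, such
  that a conjunction of literals is its own syntactic implicant.
\<close>

definition sip_qf ::
  "('s, 'f, 'r) background \<Rightarrow> ('f, 'r, 's var) qf \<Rightarrow> ('f, 's) valuation \<Rightarrow> ('f, 'r, 's var) qf" where
  "sip_qf A \<psi> \<sigma> = Conj (filter (qf_holds A \<sigma>) (literals \<psi>))"

definition sip_chc ::
  "('s, 'f, 'r) background \<Rightarrow> ('f, 'r, 'p, 's) chc \<Rightarrow> ('f, 'r, 'p, 's) chc set" where
  "sip_chc A \<phi> =
     {CHC (body \<phi>) (sip_qf A (cond \<phi>) \<sigma>) (head \<phi>) | \<sigma>.
        \<sigma> \<in> valuations A \<and> qf_holds A \<sigma> (cond \<phi>)}"

definition sip ::
  "('s, 'f, 'r) background \<Rightarrow> ('f, 'r, 'p, 's) chc set \<Rightarrow> ('f, 'r, 'p, 's) chc set" where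
  "sip A \<Pi> = (\<Union>\<phi>\<in>\<Pi>. sip_chc A \<phi>)"

definition redundant ::
  "('s, 'f, 'r) background \<Rightarrow> ('f, 'r, 'p, 's) chc \<Rightarrow> ('f, 'r, 'p, 's) chc set \<Rightarrow> bool" where
  "redundant A \<phi> \<Pi> \<longleftrightarrow> (\<exists>\<pi>\<in>\<Pi>. grnd A \<phi> \<subseteq> grnd A \<pi>)"

definition strictly_redundant ::
  "('s, 'f, 'r) background \<Rightarrow> ('f, 'r, 'p, 's) chc \<Rightarrow> ('f, 'r, 'p, 's) chc set \<Rightarrow> bool" where
  "strictly_redundant A \<phi> \<Pi> \<longleftrightarrow> (\<exists>\<pi>\<in>\<Pi>. grnd A \<phi> \<subset> grnd A \<pi>)"

section \<open>The calculus\<close>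

type_synonym ('f, 'r, 'p, 's) languages = "('f, 'r, 'p, 's) chc \<Rightarrow> ('f, 'r, 'p, 's) chc list set"

definition lang_seq ::
  "('f, 'r, 'p, 's) languages \<Rightarrow> ('f, 'r, 'p, 's) chc list \<Rightarrow> ('f, 'r, 'p, 's) chc list set" where
  "lang_seq L \<phi>s = {concat ws | ws. list_all2 (\<lambda>w \<phi>. w \<in> L \<phi>) ws \<phi>s}"

definition kleene_plus :: "'a list set \<Rightarrow> 'a list set" where
  "kleene_plus K = {concat ws | ws. ws \<noteq> [] \<and> set ws \<subseteq> K}"

text \<open>
  \<open>Start \<Phi>\<close> is the original CHC problem, before the rule \<open>Init\<close> has been applied. A state consists
  of the clauses, the trace, the blocking sets and the language component, which is never
  inspected.
\<close>

datatype ('f, 'r, 'p, 's) config =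
  Start "('f, 'r, 'p, 's) chc set"
| State "('f, 'r, 'p, 's) chc set" "('f, 'r, 'p, 's) chc list" "('f, 'r, 'p, 's) chc set list"
    "('f, 'r, 'p, 's) languages"
| Unsat
| Sat

definition active ::
  "('s, 'f, 'r) background \<Rightarrow> ('f, 'r, 'p, 's) chc list \<Rightarrow> ('f, 'r, 'p, 's) chc set list
   \<Rightarrow> ('f, 'r, 'p, 's) chc \<Rightarrow> bool" where
  "active A \<phi>s Bs \<phi> \<longleftrightarrow>
     \<not> redundant A \<phi> (last Bs) \<and> cond_satisfiable A (res_seq (\<phi>s @ [\<phi>]))"

fun bt :: "('f, 'r, 'p, 's) config \<Rightarrow> ('f, 'r, 'p, 's) config" where
  "bt (State \<Pi> \<phi>s Bs L) =
     State \<Pi> (butlast \<phi>s) (butlast (butlast Bs) @ [last (butlast Bs) \<union> {last \<phi>s}]) L"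
| "bt c = c"

definition covered ::
  "('s, 'f, 'r) background \<Rightarrow> ('f, 'r, 'p, 's) chc set \<Rightarrow> ('f, 'r, 'p, 's) chc list \<Rightarrow> bool" where
  "covered A \<Pi> \<phi>s \<longleftrightarrow>
     \<phi>s \<noteq> [] \<and>
     (strictly_redundant A (res_seq \<phi>s) (sip A \<Pi>) \<or>
      redundant A (res_seq \<phi>s) (sip A \<Pi>) \<and> length \<phi>s > 1)"

text \<open>
  Transitions are labelled with the rule, because a strategy has to distinguish applications of
  different rules (\<open>Covered\<close> and \<open>Backtrack\<close> can lead to the same state).
\<close>

datatype ('f, 'r, 'p, 's) adcl_rule =
  Init | Step "('f, 'r, 'p, 's) chc" | Accelerate "('f, 'r, 'p, 's) chc list"
| Covered | Backtrack | Refute | Prove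

inductive adcl ::
  "('s, 'f, 'r) background \<Rightarrow> (('f, 'r, 'p, 's) chc \<Rightarrow> ('f, 'r, 'p, 's) chc)
   \<Rightarrow> ('f, 'r, 'p, 's) adcl_rule \<Rightarrow> ('f, 'r, 'p, 's) config \<Rightarrow> ('f, 'r, 'p, 's) config \<Rightarrow> bool"
  for A accel where
  adcl_init:
    "adcl A accel Init (Start \<Phi>) (State \<Phi> [] [{}] (\<lambda>\<phi>. if \<phi> \<in> sip A \<Phi> then {[\<phi>]} else {}))"
| adcl_step:
    "\<phi> \<in> sip A \<Pi> \<Longrightarrow> active A \<phi>s Bs \<phi> \<Longrightarrow>
     adcl A accel (Step \<phi>) (State \<Pi> \<phi>s Bs L) (State \<Pi> (\<phi>s @ [\<phi>]) (Bs @ [{}]) L)"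
| adcl_accelerate:
    "\<phi>s' \<noteq> [] \<Longrightarrow> recursive (res_seq \<phi>s') \<Longrightarrow> length \<phi>s' = length Bs' \<Longrightarrow>
     accel (res_seq \<phi>s') = \<phi> \<Longrightarrow>
     adcl A accel (Accelerate \<phi>s') (State \<Pi> (\<phi>s @ \<phi>s') (Bs @ Bs') L)
       (State (\<Pi> \<union> {\<phi>}) (\<phi>s @ [\<phi>]) (Bs @ [{\<phi>}]) (L(\<phi> := kleene_plus (lang_seq L \<phi>s'))))"
| adcl_covered:
    "covered A \<Pi> \<phi>s' \<Longrightarrow> s = State \<Pi> (\<phi>s @ \<phi>s') Bs L \<Longrightarrow> adcl A accel Covered s (bt s)"
| adcl_backtrack:
    "\<forall>\<psi>\<in>sip A \<Pi>. is_rule \<psi> \<or> is_query \<psi> \<longrightarrow> \<not> active A (\<phi>s @ [\<phi>]) Bs \<psi> \<Longrightarrow> \<not> is_query \<phi> \<Longrightarrow>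
     s = State \<Pi> (\<phi>s @ [\<phi>]) Bs L \<Longrightarrow> adcl A accel Backtrack s (bt s)"
| adcl_refutation:
    "\<phi>s \<noteq> [] \<Longrightarrow> is_refutation A (res_seq \<phi>s) \<Longrightarrow>
     adcl A accel Refute (State \<Pi> \<phi>s Bs L) Unsat"
| adcl_prove:
    "\<forall>\<psi>\<in>sip A \<Pi>. is_fact \<psi> \<or> is_cond_empty \<psi> \<longrightarrow> \<not> active A [] [B] \<psi> \<Longrightarrow>
     adcl A accel Prove (State \<Pi> [] [B] L) Sat"

section \<open>Reasonable strategies\<close>

text \<open>
  The suffixes of the trace that may be accelerated under a reasonable strategy, if they are as
  short as possible.
\<close>

definition accel_candidate ::
  "('s, 'f, 'r) background \<Rightarrow> (('f, 'r, 'p, 's) chc \<Rightarrow> ('f, 'r, 'p, 's) chc)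
   \<Rightarrow> ('f, 'r, 'p, 's) chc set \<Rightarrow> ('f, 'r, 'p, 's) chc list \<Rightarrow> ('f, 'r, 'p, 's) chc list \<Rightarrow> bool"
  where
  "accel_candidate A accel \<Pi> \<phi>s \<phi>s' \<longleftrightarrow>
     suffix \<phi>s' \<phi>s \<and> \<phi>s' \<noteq> [] \<and> recursive (res_seq \<phi>s') \<and>
     \<not> redundant A (accel (res_seq \<phi>s')) (sip A \<Pi>)"

text \<open>
  A strategy may depend on the configurations \<open>cs\<close> visited before the current one. They are
  needed for the first condition, which compares the current state to an earlier state with the
  same clauses.
\<close>

fun reasonable ::
  "('s, 'f, 'r) background \<Rightarrow> (('f, 'r, 'p, 's) chc \<Rightarrow> ('f, 'r, 'p, 's) chc)
   \<Rightarrow> ('f, 'r, 'p, 's) config list \<Rightarrow> ('f, 'r, 'p, 's) config \<Rightarrow> ('f, 'r, 'p, 's) adcl_rule \<Rightarrow> bool"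
  where
  "reasonable A accel cs (State \<Pi> \<phi>s Bs L) r \<longleftrightarrow>
     ((\<exists>\<psi>s \<psi>s' Bs' L'. \<phi>s = \<psi>s @ \<psi>s' \<and> covered A \<Pi> \<psi>s' \<and> State \<Pi> \<psi>s Bs' L' \<in> set cs)
        \<longrightarrow> r = Covered) \<and>
     (\<forall>\<phi>. r = Step \<phi> \<longrightarrow> \<not> (\<exists>\<phi>s'. accel_candidate A accel \<Pi> \<phi>s \<phi>s')) \<and>
     (\<forall>\<phi>s'. r = Accelerate \<phi>s' \<longrightarrow>
        accel_candidate A accel \<Pi> \<phi>s \<phi>s' \<and>
        (\<forall>\<phi>s''. accel_candidate A accel \<Pi> \<phi>s \<phi>s'' \<longrightarrow> length \<phi>s' \<le> length \<phi>s'')) \<and>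
     (\<forall>\<phi>. r = Step \<phi> \<longrightarrow> \<phi>s = [] \<longrightarrow> is_fact \<phi> \<or> is_cond_empty \<phi>)"
| "reasonable A accel cs _ r \<longleftrightarrow> True"

text \<open>
  As the strategy depends on the history, the relation is defined on non-empty derivations, whose
  last element is the current configuration.
\<close>

inductive adcl_rs ::
  "('s, 'f, 'r) background \<Rightarrow> (('f, 'r, 'p, 's) chc \<Rightarrow> ('f, 'r, 'p, 's) chc)
   \<Rightarrow> ('f, 'r, 'p, 's) config list \<Rightarrow> ('f, 'r, 'p, 's) config list \<Rightarrow> bool"
  for A accel where
  "adcl A accel r c c' \<Longrightarrow> reasonable A accel cs c r \<Longrightarrow>
   adcl_rs A accel (cs @ [c]) (cs @ [c, c'])"

end

theory Submission
  imports Defs "HOL-Library.Countable"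
begin

text \<open>
  Let \<open>c\<^sub>0, c\<^sub>1, \<dots>\<close> be constants, let \<open>w\<close> be an infinite square-free word over four letters, and let
  \<open>R\<^sub>a(c\<^sub>n, c\<^sub>n\<^sub>+\<^sub>1)\<close> hold iff the letter at position \<open>n\<close> of \<open>w\<close> is \<open>a\<close>. The problem consists of the fact
  \<open>F(c\<^sub>0)\<close> and the four rules \<open>F(x) \<and> R\<^sub>a(x, y) \<Rightarrow> F(y)\<close>; without queries, it is satisfiable. A trace spells
  a factor of \<open>w\<close>, and the ground instances of its resolvent are the occurrences of that factor. As
  \<open>w\<close> has no squares, acceleration never adds ground instances. Hence every clause ever learned
  covers a single factor of finite length, so a trace can always be continued, and the calculus
  never backtracks beyond the fact.
\<close>

section \<open>Resolution as relational composition\<close>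

text \<open>The trace does shrink: \<open>Covered\<close> and \<open>Backtrack\<close> remove
  clauses and block them. The danger is that blocked clauses pile up until nothing can follow the
  fact. The invariant built on \<open>superseded\<close> excludes this by comparing how far clauses
  reach. A furthest-reaching clause exists because the clause set is finite and a clause spelling
  one factor has at most one ground instance (an edge between positions) leaving a given position.

  The other obstacle is the theory. The claim covers every richer theory and every acceleration
  technique, so an accelerated clause is known only through what the definition of a technique
  grants: above all, its ground instances are the transitive closure of those of the given clause.
  The claim would be vacuous if no technique existed, so \<open>word_theory\<close> contains symbols
  for such closures.

  Square-free words over three letters exist as well; the fourth letter buys a short proof.\<close>

lemma eval_rename: "eval A \<sigma> (rename_tm \<rho> t) = eval A (\<sigma> \<circ> \<rho>) t"
  by (induction t) (simp_all cong: map_cong)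

lemma atm_holds_rename: "atm_holds A \<sigma> (rename_atm \<rho> a) = atm_holds A (\<sigma> \<circ> \<rho>) a"
  by (cases a) (simp_all add: eval_rename comp_def)

lemma qf_holds_rename: "qf_holds A \<sigma> (rename_qf \<rho> \<psi>) = qf_holds A (\<sigma> \<circ> \<rho>) \<psi>"
  by (induction \<psi>) (simp_all add: atm_holds_rename comp_def)

lemma eval_cong: "(\<And>v. v \<in> vars_tm t \<Longrightarrow> \<sigma> v = \<tau> v) \<Longrightarrow> eval A \<sigma> t = eval A \<tau> t"
proof (induction t)
  case (Fun f ts)
  have "map (eval A \<sigma>) ts = map (eval A \<tau>) ts"
    using Fun.prems by (intro map_cong refl Fun.IH) auto
  then show ?case by (simp only: eval.simps)
qed simp

lemma atm_holds_cong:
  "(\<And>v. v \<in> vars_atm a \<Longrightarrow> \<sigma> v = \<tau> v) \<Longrightarrow> atm_holds A \<sigma> a = atm_holds A \<tau> a"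
proof (cases a)
  case (Eq t u)
  assume "\<And>v. v \<in> vars_atm a \<Longrightarrow> \<sigma> v = \<tau> v"
  then show ?thesis using Eq eval_cong[of t \<sigma> \<tau> A] eval_cong[of u \<sigma> \<tau> A] by simp
next
  case (Rel r ts)
  assume "\<And>v. v \<in> vars_atm a \<Longrightarrow> \<sigma> v = \<tau> v"
  then have "map (eval A \<sigma>) ts = map (eval A \<tau>) ts"
    using Rel by (auto intro!: eval_cong)
  then show ?thesis unfolding Rel by (simp only: atm_holds.simps)
qed

lemma qf_holds_cong:
  "(\<And>v. v \<in> vars_qf \<psi> \<Longrightarrow> \<sigma> v = \<tau> v) \<Longrightarrow> qf_holds A \<sigma> \<psi> = qf_holds A \<tau> \<psi>"
proof (induction \<psi>)
  case (Lit b a)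
  then show ?case using atm_holds_cong[of a \<sigma> \<tau> A] by simp
qed (simp_all, blast+)

lemma fm_holds_cong:
  "(\<And>v. v \<in> free_vars \<phi> \<Longrightarrow> \<sigma> v = \<tau> v) \<Longrightarrow> fm_holds A \<sigma> \<phi> = fm_holds A \<tau> \<phi>"
proof (induction \<phi> arbitrary: \<sigma> \<tau>)
  case (Atom a)
  then show ?case using atm_holds_cong[of a \<sigma> \<tau> A] by simp
next
  case (Neg \<phi>)
  then show ?case by (metis fm_holds.simps(2) free_vars.simps(2))
next
  case (And \<phi> \<psi>)
  then show ?case by (metis UnCI fm_holds.simps(3) free_vars.simps(3))
next
  case (All v \<phi>)
  have "fm_holds A (\<sigma>(v := t)) \<phi> = fm_holds A (\<tau>(v := t)) \<phi>" for t
    using All.prems by (intro All.IH) auto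
  then show ?case by simp
qed

lemma qf_holds_qf_and: "qf_holds A \<sigma> (qf_and \<psi> \<psi>') \<longleftrightarrow> qf_holds A \<sigma> \<psi> \<and> qf_holds A \<sigma> \<psi>'"
  by (cases \<psi>; cases \<psi>') (auto simp: qf_and_def)

lemma has_sort_rename:
  "has_sort A t s \<Longrightarrow> (\<And>v. snd (\<rho> v) = snd v) \<Longrightarrow> has_sort A (rename_tm \<rho> t) s"
proof (induction rule: has_sort.induct)
  case (1 s n)
  have "\<rho> (n, s) = (fst (\<rho> (n, s)), s)" using 1(2)[of "(n, s)"] by (simp add: prod_eq_iff)
  then show ?case using 1(1) by (metis has_sort.intros(1) tm.map(1))
next
  case (2 f ss s ts)
  then show ?case
    by (auto intro!: has_sort.intros simp: list_all2_conv_all_nth)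
qed

lemma wf_atm_rename:
  assumes "\<And>v. snd (\<rho> v) = snd v" "wf_atm A a"
  shows "wf_atm A (rename_atm \<rho> a)"
  using assms has_sort_rename[of A _ _ \<rho>]
  by (cases a) (auto simp: list_all2_conv_all_nth, blast+)

lemma wf_qf_rename:
  "(\<And>v. snd (\<rho> v) = snd v) \<Longrightarrow> wf_qf A \<psi> \<Longrightarrow> wf_qf A (rename_qf \<rho> \<psi>)"
  by (induction \<psi>) (auto simp: wf_atm_rename list_all_iff)

lemma wf_qf_and: "wf_qf A (qf_and \<psi> \<psi>') \<longleftrightarrow> wf_qf A \<psi> \<and> wf_qf A \<psi>'"
  by (cases \<psi>; cases \<psi>') (auto simp: qf_and_def)

lemma finite_vars_tm: "finite (vars_tm t)"
  by (induction t) auto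

lemma finite_vars_qf: "finite (vars_qf \<psi>)"
proof (induction \<psi>)
  case (Lit b a)
  then show ?case by (cases a) (auto simp: finite_vars_tm)
qed auto

lemma finite_chc_vars: "finite (chc_vars \<phi>)"
  by (simp add: chc_vars_def finite_vars_qf)

lemma valuations_comp:
  "\<sigma> \<in> valuations A \<Longrightarrow> (\<And>v. snd (\<rho> v) = snd v) \<Longrightarrow> \<sigma> \<circ> \<rho> \<in> valuations A"
  unfolding valuations_def by (auto, metis prod.collapse snd_conv)

section \<open>Renaming apart and unification\<close>

lemma snd_mgu:
  assumes "map snd xs = map snd ys"
  shows "snd (mgu xs ys v) = snd v"
proof (cases "map_of (zip ys xs) v")
  case (Some x)
  then have "(v, x) \<in> set (zip ys xs)" by (rule map_of_SomeD)
  then obtain i where "i < length ys" "i < length xs" "v = ys ! i" "x = xs ! i"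
    by (auto simp: set_zip)
  then have "snd x = snd v" using assms by (metis nth_map)
  then show ?thesis using Some by (simp add: mgu_def)
qed (simp add: mgu_def)

lemma mgu_other: "v \<notin> set ys \<Longrightarrow> mgu xs ys v = v"
  by (auto simp: mgu_def split: option.split dest: map_of_SomeD set_zip_leftD)

text \<open>The renaming hidden in \<open>rename_apart\<close>. Once \<open>res_eq\<close> is
  proved, only freshness, injectivity and preservation of sorts are used.\<close>

definition shift_by :: "('f, 'r, 'p, 's) chc \<Rightarrow> 's var \<Rightarrow> 's var" where
  "shift_by \<phi> = (\<lambda>(n, s). (n + Suc (Max (insert 0 (fst ` chc_vars \<phi>))), s))"

lemma shift_by_fresh: "shift_by \<phi> v \<notin> chc_vars \<phi>"
proof
  assume "shift_by \<phi> v \<in> chc_vars \<phi>"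
  then have "fst (shift_by \<phi> v) \<le> Max (insert 0 (fst ` chc_vars \<phi>))"
    by (intro Max_ge) (auto simp: finite_chc_vars)
  then show False by (simp add: shift_by_def split: prod.splits)
qed

lemma inj_shift_by: "inj (shift_by \<phi>)"
  by (auto simp: inj_def shift_by_def)

lemma snd_shift_by: "snd (shift_by \<phi> v) = snd v"
  by (simp add: shift_by_def split: prod.splits)

lemma res_eq:
  assumes "head \<phi> = Some (F, xs)" "body \<phi>' = Some (F, ys)"
  shows "res \<phi> \<phi>' =
    rename_chc (mgu xs (map (shift_by \<phi>) ys))
      (CHC (body \<phi>) (qf_and (cond \<phi>) (rename_qf (shift_by \<phi>) (cond \<phi>')))
        (map_option (apsnd (map (shift_by \<phi>))) (head \<phi>')))"
  using assms
  by (simp add: res_def rename_apart_def rename_chc_def shift_by_def[abs_def] Let_def)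

lemma same_sorts:
  assumes "is_chc A Sig \<phi>" "is_chc A Sig \<phi>'" "head \<phi> = Some (F, xs)" "body \<phi>' = Some (F, ys)"
  shows "map snd xs = map snd ys"
  using assms by (simp add: is_chc_def wf_patom_def)

text \<open>Ground instances form a relation between ground bodies and ground heads. Resolution
  identifies the head of the first clause with the body of the second, which is exactly the middle
  point of a composition.\<close>

lemma grnd_res:
  assumes "is_chc A Sig \<phi>" "is_chc A Sig \<phi>'" "head \<phi> = Some (F, xs)" "body \<phi>' = Some (F, ys)"
  shows "grnd A (res \<phi> \<phi>') = grnd A \<phi> O grnd A \<phi>'"
proof -
  let ?\<rho> = "shift_by \<phi>"
  let ?\<theta> = "mgu xs (map ?\<rho> ys)"
  have sorts: "map snd xs = map snd (map ?\<rho> ys)"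
    using same_sorts[OF assms] by (simp add: snd_shift_by comp_def)
  have xs: "set xs \<subseteq> chc_vars \<phi>" using assms(3) by (auto simp: chc_vars_def args_def)
  have bd: "set (args (body \<phi>)) \<subseteq> chc_vars \<phi>" by (auto simp: chc_vars_def)
  have "distinct ys" using assms(2,4) by (simp add: is_chc_def args_def)
  then have unif: "map ?\<theta> xs = map ?\<theta> (map ?\<rho> ys)"
    using xs shift_by_fresh[of \<phi>] arg_cong[OF sorts, of length] inj_shift_by[of \<phi>]
    by (intro mgu_unifies) (auto simp: distinct_map inj_on_subset[OF inj_shift_by])
  have grnd: "grnd A (res \<phi> \<phi>') =
    {(map_option (apsnd (map (\<sigma> \<circ> ?\<theta>))) (body \<phi>), map_option (apsnd (map (\<sigma> \<circ> ?\<theta> \<circ> ?\<rho>))) (head \<phi>')) | \<sigma>.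
       \<sigma> \<in> valuations A \<and> qf_holds A (\<sigma> \<circ> ?\<theta>) (cond \<phi>) \<and> qf_holds A (\<sigma> \<circ> ?\<theta> \<circ> ?\<rho>) (cond \<phi>')}"
    unfolding res_eq[OF assms(3,4)] grnd_def
    by (simp add: rename_chc_def qf_holds_rename qf_holds_qf_and option.map_comp comp_def
        apsnd_def map_prod_def split_def)
  show ?thesis
  proof (intro equalityI subrelI)
    fix b h assume "(b, h) \<in> grnd A (res \<phi> \<phi>')"
    then obtain \<sigma> where \<sigma>: "\<sigma> \<in> valuations A" "qf_holds A (\<sigma> \<circ> ?\<theta>) (cond \<phi>)"
      "qf_holds A (\<sigma> \<circ> ?\<theta> \<circ> ?\<rho>) (cond \<phi>')"
      "b = map_option (apsnd (map (\<sigma> \<circ> ?\<theta>))) (body \<phi>)"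
      "h = map_option (apsnd (map (\<sigma> \<circ> ?\<theta> \<circ> ?\<rho>))) (head \<phi>')"
      unfolding grnd by blast
    have v1: "\<sigma> \<circ> ?\<theta> \<in> valuations A" by (intro valuations_comp \<sigma> snd_mgu sorts)
    have v2: "\<sigma> \<circ> ?\<theta> \<circ> ?\<rho> \<in> valuations A" by (intro valuations_comp v1 snd_shift_by)
    have "map (\<sigma> \<circ> ?\<theta>) xs = map (\<sigma> \<circ> ?\<theta> \<circ> ?\<rho>) ys"
      using arg_cong[OF unif, of "map \<sigma>"] by (simp add: comp_def)
    then have "map_option (apsnd (map (\<sigma> \<circ> ?\<theta>))) (head \<phi>)
        = map_option (apsnd (map (\<sigma> \<circ> ?\<theta> \<circ> ?\<rho>))) (body \<phi>')"
      using assms(3,4) by simp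
    moreover have "(b, map_option (apsnd (map (\<sigma> \<circ> ?\<theta>))) (head \<phi>)) \<in> grnd A \<phi>"
      unfolding grnd_def \<sigma>(4) using v1 \<sigma>(2) by blast
    moreover have "(map_option (apsnd (map (\<sigma> \<circ> ?\<theta> \<circ> ?\<rho>))) (body \<phi>'), h) \<in> grnd A \<phi>'"
      unfolding grnd_def \<sigma>(5) using v2 \<sigma>(3) by blast
    ultimately show "(b, h) \<in> grnd A \<phi> O grnd A \<phi>'" by auto
  next
    fix b h assume "(b, h) \<in> grnd A \<phi> O grnd A \<phi>'"
    then obtain \<sigma>1 \<sigma>2 where \<sigma>1: "\<sigma>1 \<in> valuations A" "qf_holds A \<sigma>1 (cond \<phi>)"
      and \<sigma>2: "\<sigma>2 \<in> valuations A" "qf_holds A \<sigma>2 (cond \<phi>')"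
      and bh: "b = map_option (apsnd (map \<sigma>1)) (body \<phi>)" "h = map_option (apsnd (map \<sigma>2)) (head \<phi>')"
      and mid: "map_option (apsnd (map \<sigma>1)) (head \<phi>) = map_option (apsnd (map \<sigma>2)) (body \<phi>')"
      unfolding grnd_def by auto
    \<comment> \<open>Glue both valuations: renamed variables are read by \<open>\<sigma>2\<close>,
      all others by \<open>\<sigma>1\<close>. No variable of \<open>\<phi>\<close> is a renamed one,
      so both clauses see their own valuation.\<close>
    define \<tau> where "\<tau> v = (if v \<in> range ?\<rho> then \<sigma>2 (inv ?\<rho> v) else \<sigma>1 v)" for v
    have \<tau>2: "\<tau> \<circ> ?\<rho> = \<sigma>2" using inj_shift_by[of \<phi>] by (auto simp: \<tau>_def fun_eq_iff)
    have \<tau>1: "\<tau> v = \<sigma>1 v" if "v \<in> chc_vars \<phi>" for v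
      using that shift_by_fresh[of \<phi>] by (auto simp: \<tau>_def)
    have "\<tau> (n, s) \<in> univ A s" if "s \<in> sorts A" for n s
    proof (cases "(n, s) \<in> range ?\<rho>")
      case True
      then obtain v where v: "(n, s) = ?\<rho> v" by auto
      then have "snd v = s" by (metis snd_conv snd_shift_by)
      moreover have "\<tau> (n, s) = \<sigma>2 v" using \<tau>2 v by auto
      ultimately show ?thesis using \<sigma>2(1) that
        by (cases v) (simp add: valuations_def)
    next
      case False
      then show ?thesis using \<sigma>1(1) that by (simp add: \<tau>_def valuations_def)
    qed
    then have \<tau>: "\<tau> \<in> valuations A" by (simp add: valuations_def)
    have "map \<tau> xs = map \<sigma>1 xs" using \<tau>1 xs by auto
    then have "map \<tau> xs = map \<tau> (map ?\<rho> ys)" using mid assms(3,4) \<tau>2 by (simp del: map_eq_conv)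
    \<comment> \<open>The glued valuation equates both argument vectors, so it factors through the
      most general unifier.\<close>
    then have \<theta>: "\<tau> \<circ> ?\<theta> = \<tau>" using mgu_most_general[of \<tau> xs] by auto
    have "qf_holds A \<tau> (cond \<phi>)"
      using \<sigma>1(2) \<tau>1 qf_holds_cong[of "cond \<phi>" \<tau> \<sigma>1 A] by (auto simp: chc_vars_def)
    moreover have "b = map_option (apsnd (map \<tau>)) (body \<phi>)"
      unfolding bh(1) using \<tau>1 bd by (cases "body \<phi>") (auto simp: args_def)
    moreover have "h = map_option (apsnd (map (\<tau> \<circ> ?\<rho>))) (head \<phi>')"
      using bh(2) \<tau>2 by simp
    ultimately show "(b, h) \<in> grnd A (res \<phi> \<phi>')"
      unfolding grnd using \<tau> \<theta> \<tau>2 \<sigma>2(2) by (intro CollectI exI[of _ \<tau>]) auto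
  qed
qed

text \<open>The unifier moves only renamed variables, which are fresh for \<open>\<phi>\<close>; so
  the body survives literally, not just up to renaming.\<close>

lemma body_res:
  assumes "is_chc A Sig \<phi>" "is_chc A Sig \<phi>'" "head \<phi> = Some (F, xs)" "body \<phi>' = Some (F, ys)"
  shows "body (res \<phi> \<phi>') = body \<phi>"
proof -
  have "v \<notin> set (map (shift_by \<phi>) ys)" if "v \<in> set (args (body \<phi>))" for v
    using that shift_by_fresh[of \<phi>] by (auto simp: chc_vars_def)
  then show ?thesis
    unfolding res_eq[OF assms(3,4)] rename_chc_def
    by (cases "body \<phi>") (auto simp: args_def apsnd_def simp del: set_map intro!: map_idI mgu_other)
qed

text \<open>Body and head of a clause share no variables, so the unifier leaves the shifted head
  alone.\<close>

lemma head_res: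
  assumes "is_chc A Sig \<phi>" "is_chc A Sig \<phi>'" "head \<phi> = Some (F, xs)" "body \<phi>' = Some (F, ys)"
  shows "head (res \<phi> \<phi>') = map_option (apsnd (map (shift_by \<phi>))) (head \<phi>')"
proof -
  have "shift_by \<phi> v \<notin> set (map (shift_by \<phi>) ys)" if "v \<in> set (args (head \<phi>'))" for v
  proof -
    have "v \<notin> set ys" using that assms(2,4) by (auto simp: is_chc_def args_def[of "Some _"])
    then show ?thesis using inj_shift_by[of \<phi>] by (simp add: inj_image_mem_iff)
  qed
  then show ?thesis
    unfolding res_eq[OF assms(3,4)] rename_chc_def
    by (cases "head \<phi>'") (auto simp: args_def apsnd_def mgu_other)
qed

lemma is_chc_res:
  assumes "is_chc A Sig \<phi>" "is_chc A Sig \<phi>'" "head \<phi> = Some (F, xs)" "body \<phi>' = Some (F, ys)"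
  shows "is_chc A Sig (res \<phi> \<phi>')"
proof -
  let ?\<rho> = "shift_by \<phi>"
  have sorts: "map snd xs = map snd (map ?\<rho> ys)"
    using same_sorts[OF assms] by (simp add: snd_shift_by comp_def)
  have "wf_qf A (cond (res \<phi> \<phi>'))"
    unfolding res_eq[OF assms(3,4)] rename_chc_def
    using assms(1,2)
    by (auto intro!: wf_qf_rename snd_mgu sorts snd_shift_by simp: wf_qf_and is_chc_def)
  moreover have "wf_patom A Sig (head (res \<phi> \<phi>'))"
    using assms(2) unfolding head_res[OF assms] is_chc_def
    by (auto simp: wf_patom_def snd_shift_by comp_def image_image split: option.splits)
  moreover have "args (head (res \<phi> \<phi>')) = map ?\<rho> (args (head \<phi>'))"
    unfolding head_res[OF assms] by (auto simp: args_def split: option.splits)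
  then have "distinct (args (body (res \<phi> \<phi>')) @ args (head (res \<phi> \<phi>')))"
    using assms(1,2) shift_by_fresh[of \<phi>] inj_shift_by[of \<phi>] unfolding body_res[OF assms]
    by (auto simp: is_chc_def distinct_map inj_on_subset[OF inj_shift_by] chc_vars_def)
  ultimately show ?thesis
    using assms(1) body_res[OF assms] by (simp add: is_chc_def)
qed

lemma conjunctive_res:
  assumes "conjunctive \<phi>" "conjunctive \<phi>'" "head \<phi> = Some (F, xs)" "body \<phi>' = Some (F, ys)"
  shows "conjunctive (res \<phi> \<phi>')"
proof -
  obtain ls ls' where "cond \<phi> = Conj ls" "\<forall>l\<in>set ls. \<exists>b a. l = Lit b a"
    "cond \<phi>' = Conj ls'" "\<forall>l\<in>set ls'. \<exists>b a. l = Lit b a"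
    using assms(1,2) by (auto simp: conjunctive_def)
  then show ?thesis
    unfolding res_eq[OF assms(3,4)] rename_chc_def conjunctive_def
    by (force simp: qf_and_def)
qed

section \<open>Sequences of clauses and powers of a recursive clause\<close>

lemma res_seq_snoc: "\<phi>s \<noteq> [] \<Longrightarrow> res_seq (\<phi>s @ [\<phi>]) = res (res_seq \<phi>s) \<phi>"
  by (induction \<phi>s rule: res_seq.induct) auto

lemma cond_satisfiable_iff_grnd: "cond_satisfiable A \<phi> \<longleftrightarrow> grnd A \<phi> \<noteq> {}"
  by (auto simp: cond_satisfiable_def grnd_def)

text \<open>A valuation that satisfies a conjunction satisfies all its literals, so filtering drops
  none of them; an unsatisfiable condition has no implicants.\<close>

lemma sip_chc_conjunctive:
  assumes "conjunctive \<phi>"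
  shows "sip_chc A \<phi> = (if cond_satisfiable A \<phi> then {\<phi>} else {})"
proof -
  obtain ls where ls: "cond \<phi> = Conj ls" "\<forall>l\<in>set ls. \<exists>b a. l = Lit b a"
    using assms by (auto simp: conjunctive_def)
  have "concat (map literals ls) = ls" using ls(2) by (induction ls) auto
  then have "sip_qf A (cond \<phi>) \<sigma> = cond \<phi>" if "qf_holds A \<sigma> (cond \<phi>)" for \<sigma>
    using that ls(1) by (simp add: sip_qf_def)
  moreover have "CHC (body \<phi>) (cond \<phi>) (head \<phi>) = \<phi>" by simp
  ultimately show ?thesis
    unfolding sip_chc_def cond_satisfiable_def by (auto intro!: exI simp del: chc.collapse)
qed

text \<open>The common predicate \<open>F\<close> guarantees that no resolution step falls into the
  default case, whose condition is falsity.\<close>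

lemma res_seq_recursive:
  assumes "\<phi>s \<noteq> []"
    and "\<And>\<phi>. \<phi> \<in> set \<phi>s \<Longrightarrow>
      is_chc A Sig \<phi> \<and> conjunctive \<phi> \<and> (\<exists>xs ys. body \<phi> = Some (F, xs) \<and> head \<phi> = Some (F, ys))"
  shows "is_chc A Sig (res_seq \<phi>s) \<and> conjunctive (res_seq \<phi>s) \<and>
    (\<exists>xs ys. body (res_seq \<phi>s) = Some (F, xs) \<and> head (res_seq \<phi>s) = Some (F, ys))"
  using assms
proof (induction \<phi>s rule: rev_nonempty_induct)
  case (snoc \<phi> \<phi>s)
  obtain xs ys where 1: "is_chc A Sig (res_seq \<phi>s)" "conjunctive (res_seq \<phi>s)"
    "body (res_seq \<phi>s) = Some (F, xs)" "head (res_seq \<phi>s) = Some (F, ys)"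
    using snoc by auto
  obtain xs' ys' where 2: "is_chc A Sig \<phi>" "conjunctive \<phi>" "body \<phi> = Some (F, xs')" "head \<phi> = Some (F, ys')"
    using snoc.prems[of \<phi>] by auto
  show ?case
    using is_chc_res[OF 1(1) 2(1) 1(4) 2(3)] conjunctive_res[OF 1(2) 2(2) 1(4) 2(3)]
      body_res[OF 1(1) 2(1) 1(4) 2(3)] head_res[OF 1(1) 2(1) 1(4) 2(3)] 1 2
    by (simp add: res_seq_snoc[OF snoc.hyps(1)])
qed simp

lemma grnd_res_seq_snoc:
  assumes "\<phi>s \<noteq> []"
    and "\<And>\<phi>. \<phi> \<in> set (\<phi>s @ [\<phi>']) \<Longrightarrow>
      is_chc A Sig \<phi> \<and> conjunctive \<phi> \<and> (\<exists>xs ys. body \<phi> = Some (F, xs) \<and> head \<phi> = Some (F, ys))"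
  shows "grnd A (res_seq (\<phi>s @ [\<phi>'])) = grnd A (res_seq \<phi>s) O grnd A \<phi>'"
proof -
  obtain xs ys where "is_chc A Sig (res_seq \<phi>s)" "head (res_seq \<phi>s) = Some (F, ys)"
    using res_seq_recursive[of \<phi>s A Sig F] assms by auto
  moreover obtain xs' where "is_chc A Sig \<phi>'" "body \<phi>' = Some (F, xs')"
    using assms(2)[of \<phi>'] by auto
  ultimately show ?thesis using grnd_res by (metis res_seq_snoc[OF assms(1)])
qed

text \<open>As resolution is composition, \<open>n\<close> copies yield the \<open>n\<close>-th
  power of the relation. This turns the defining equation of acceleration into a transitive
  closure.\<close>

lemma grnd_powers:
  assumes "is_chc A Sig \<phi>" "conjunctive \<phi>" "recursive \<phi>"
  shows "(\<Union>n\<in>{1..}. grnd A (res_seq (replicate n \<phi>))) = (grnd A \<phi>)\<^sup>+"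
proof -
  obtain F where F: "\<exists>xs ys. body \<phi> = Some (F, xs) \<and> head \<phi> = Some (F, ys)"
    using assms(3) by (auto simp: recursive_def)
  have pow: "grnd A (res_seq (replicate (Suc n) \<phi>)) = grnd A \<phi> ^^ Suc n" for n
  proof (induction n)
    case (Suc n)
    have "grnd A (res_seq (replicate (Suc n) \<phi> @ [\<phi>])) = grnd A (res_seq (replicate (Suc n) \<phi>)) O grnd A \<phi>"
      by (rule grnd_res_seq_snoc[where Sig = Sig and F = F]) (use assms F in auto)
    then show ?case using Suc
      by (metis relpow.simps(2) replicate_Suc replicate_append_same)
  qed simp
  have "{1..} = Suc ` UNIV" by (auto simp: image_iff) (metis Suc_le_D)
  then have "(\<Union>n\<in>{1..}. grnd A (res_seq (replicate n \<phi>))) = (\<Union>n. grnd A \<phi> ^^ Suc n)"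
    using pow by (simp only: image_image)
  also have "\<dots> = (grnd A \<phi>)\<^sup>+"
    using trancl_power[of _ "grnd A \<phi>"] by (auto simp del: relpow.simps) (metis Suc_pred)
  finally show ?thesis .
qed

section \<open>A square-free word over four letters\<close>

text \<open>
  Pairing the paperfolding word with the parity of the position makes it square-free: the
  paperfolding word itself has no squares of even period.
\<close>

function paperfold :: "nat \<Rightarrow> bool" where
  "paperfold n = (if even n then even (n div 2) else paperfold (n div 2))"
  by auto
termination by (relation "measure id") (auto elim: oddE)

declare paperfold.simps [simp del]

lemma paperfold_even: "paperfold (2 * n) = even n"
  by (subst paperfold.simps) simp

lemma paperfold_odd: "paperfold (Suc (2 * n)) = paperfold n"
  by (subst paperfold.simps) simp

text \<open>Write the period as \<open>2 * q\<close>. If \<open>q\<close> is even, the odd positions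
  of a square would form a square of period \<open>q\<close> in the same word. If \<open>q\<close>
  is odd, an even position suffices: the entries at even positions alternate, and a shift by
  \<open>q\<close> of them flips the value.\<close>

lemma paperfold_no_even_square:
  "even p \<Longrightarrow> 0 < p \<Longrightarrow> \<exists>j<p. paperfold (i + j) \<noteq> paperfold (i + p + j)"
proof (induction p arbitrary: i rule: less_induct)
  case (less p)
  obtain q where q: "p = 2 * q" "0 < q" using less.prems by auto
  show ?case
  proof (cases "even q")
    case True
    define m where "m = i div 2"
    have "\<exists>j<q. paperfold (m + j) \<noteq> paperfold (m + q + j)"
      using less.IH[of q] True q by simp
    then obtain j where j: "j < q" "paperfold (m + j) \<noteq> paperfold (m + q + j)" by blast
    \<comment> \<open>The offset from \<open>i\<close> of the odd position that copies entry
      \<open>m + j\<close>; the first odd position from \<open>i\<close> on copies entry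
      \<open>m\<close>, whatever the parity of \<open>i\<close>.\<close>
    define j' where "j' = Suc (2 * (m + j)) - i"
    have i: "i = 2 * m \<or> i = Suc (2 * m)" unfolding m_def by presburger
    have "i + j' = Suc (2 * (m + j))" "j' < p"
      using i j(1) q(1) by (auto simp: j'_def)
    moreover from this have "i + p + j' = Suc (2 * (m + q + j))" using q(1) by simp
    ultimately show ?thesis using j(2) paperfold_odd by metis
  next
    case False
    \<comment> \<open>Offset of the first even position from \<open>i\<close> on; it is at most 1
      and hence lies within the period.\<close>
    define j where "j = i mod 2"
    define m where "m = (i + j) div 2"
    have "i + j = 2 * m" unfolding m_def j_def by presburger
    moreover from this have "i + p + j = 2 * (m + q)" using q(1) by simp
    moreover have "j < p" using q by (simp add: j_def)
    moreover have "even m \<noteq> even (m + q)" using False by simp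
    ultimately show ?thesis using paperfold_even by metis
  qed
qed

definition letter :: "nat \<Rightarrow> nat" where
  "letter n = 2 * of_bool (paperfold n) + n mod 2"

lemma letter_less: "letter n < 4"
  by (simp add: letter_def) (auto simp: of_bool_def)

lemma letter_eq: "letter m = letter n \<longleftrightarrow> paperfold m = paperfold n \<and> even m = even n"
  unfolding letter_def by (cases "even m"; cases "even n") (auto simp: of_bool_def mod2_eq_if)

text \<open>An odd period is refuted by the parity bit of the first letter, an even one by the
  paperfolding bit.\<close>

lemma letter_square_free:
  assumes "0 < l"
  shows "\<exists>j<l. letter (n + j) \<noteq> letter (n + l + j)"
proof (cases "even l")
  case True
  then show ?thesis using paperfold_no_even_square[OF _ assms] by (metis letter_eq)
next
  case False
  then show ?thesis using assms by (intro exI[of _ 0]) (simp add: letter_eq)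
qed

section \<open>The background theory and the CHC problem\<close>

text \<open>Countability allows a relation symbol, which is a number, to code a whole
  clause.\<close>

instance tm :: (countable, countable) countable by countable_datatype
instance atm :: (countable, countable, countable) countable by countable_datatype
instance qf :: (countable, countable, countable) countable by countable_datatype
instance chc :: (countable, countable, countable, countable) countable by countable_datatype

abbreviation const :: "nat \<Rightarrow> (nat, nat var) tm" where
  "const n \<equiv> Fun n []"

text \<open>The atom \<open>F(c_n)\<close> in the form in which it occurs in \<open>grnd\<close>, so
  that positions of the word become points of the relations.\<close>

definition at :: "nat \<Rightarrow> (nat \<times> (nat, nat var) tm list) option" where
  "at n = Some (0, [const n])"

lemma at_inject [simp]: "at m = at n \<longleftrightarrow> m = n"
  by (simp add: at_def)

lemma at_neq_None [simp]: "at n \<noteq> None" "None \<noteq> at n"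
  by (simp_all add: at_def)

text \<open>The axioms are all true sentences, which makes the theory complete by construction. They
  are filled in at a second stage, because \<open>sentences\<close> and \<open>fm_holds\<close>
  already take a theory as argument.\<close>

definition const_background ::
  "(nat \<Rightarrow> (nat, nat var) tm list \<Rightarrow> bool) \<Rightarrow> (nat, nat, nat) background" where
  "const_background I =
     (let A = \<lparr>sorts = {0}, fun_type = (\<lambda>_. Some ([], 0)), rel_type = (\<lambda>_. Some [0, 0]),
        axs = {}, univ = (\<lambda>_. range const), fun_int = (\<lambda>f _. const f), rel_int = I\<rparr>
      in A\<lparr>axs := {\<phi> \<in> sentences A. \<forall>\<sigma>\<in>valuations A. fm_holds A \<sigma> \<phi>}\<rparr>)"

lemma const_background_simps [simp]:
  "sorts (const_background I) = {0}"
  "fun_type (const_background I) f = Some ([], 0)"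
  "rel_type (const_background I) r = Some [0, 0]"
  "univ (const_background I) s = range const"
  "fun_int (const_background I) f ts = const f"
  "rel_int (const_background I) = I"
  by (simp_all add: const_background_def Let_def)

text \<open>
  The symbols 0 to 3 relate successive positions of the word. A symbol \<open>r \<ge> 4\<close> denotes the
  transitive closure of a clause that is coded by \<open>r\<close>, where only symbols below \<open>r\<close> have their
  meaning; the second component of the code makes room for arbitrarily large codes of each clause.
  Hence acceleration does not lead out of this theory.
\<close>

definition decode_chc :: "nat \<Rightarrow> (nat, nat, nat, nat) chc" where
  "decode_chc r = from_nat (fst (prod_decode (r - 4)))"

fun rel_meaning :: "nat \<Rightarrow> (nat, nat var) tm list \<Rightarrow> bool" where
  "rel_meaning r ts =
     (if r < 4 then \<exists>n. ts = [const n, const (Suc n)] \<and> letter n = r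
      else \<exists>t u. ts = [t, u] \<and> (Some (0, [t]), Some (0, [u])) \<in>
        (grnd (const_background (\<lambda>r'. if r' < r then rel_meaning r' else (\<lambda>_. False))) (decode_chc r))\<^sup>+)"

declare rel_meaning.simps [simp del]

definition word_theory :: "(nat, nat, nat) background" where
  "word_theory = const_background rel_meaning"

lemma eval_const_background: "eval (const_background I) \<sigma> t = eval (const_background I') \<sigma> t"
  by (induction t) (simp_all cong: map_cong)

lemma valuations_const_background: "valuations (const_background I) = valuations (const_background I')"
  by (simp add: valuations_def)

text \<open>Equations do not depend on the interpretation of relation symbols. This permits
  replacing the truncated interpretation in \<open>rel_meaning\<close> by the full one.\<close>

lemma grnd_const_background_cong:
  assumes "cond \<phi> = Conj ls" "\<forall>l\<in>set ls. \<exists>b a. l = Lit b a"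
    and "\<And>b r ts. Lit b (Rel r ts) \<in> set ls \<Longrightarrow> I r = I' r"
  shows "grnd (const_background I) \<phi> = grnd (const_background I') \<phi>"
proof -
  have "qf_holds (const_background I) \<sigma> l = qf_holds (const_background I') \<sigma> l" if l_in: "l \<in> set ls" for l \<sigma>
  proof -
    obtain b a where l: "l = Lit b a" using assms(2) l_in by blast
    show ?thesis
    proof (cases a)
      case (Eq t u)
      then show ?thesis using l eval_const_background[of I \<sigma> _ I'] by simp
    next
      case (Rel r ts)
      have "map (eval (const_background I) \<sigma>) ts = map (eval (const_background I') \<sigma>) ts"
        using eval_const_background unfolding map_eq_conv by blast
      then show ?thesis using l Rel assms(3) l_in by (simp del: map_eq_conv)
    qed
  qed
  then have "qf_holds (const_background I) \<sigma> (cond \<phi>) = qf_holds (const_background I') \<sigma> (cond \<phi>)" for \<sigma>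
    using assms(1) by simp
  then show ?thesis unfolding grnd_def using valuations_const_background[of I I'] by simp
qed

text \<open>Together with the next two lemmas: filling in the axioms does not change the notions
  from which they were computed.\<close>

lemma has_sort_axs: "has_sort (A\<lparr>axs := X\<rparr>) = has_sort A"
proof -
  have "has_sort (A\<lparr>axs := X\<rparr>) t s \<Longrightarrow> has_sort (A\<lparr>axs := Y\<rparr>) t s" for X Y t s
    by (induction rule: has_sort.induct) (auto intro: has_sort.intros elim: list_all2_mono)
  from this[of X _ _ "axs A"] this[of "axs A" _ _ X] show ?thesis by (auto simp: fun_eq_iff)
qed

lemma sentences_axs: "sentences (A\<lparr>axs := X\<rparr>) = sentences A"
proof -
  have "wf_atm (A\<lparr>axs := X\<rparr>) a = wf_atm A a" for a
    by (cases a) (simp_all add: has_sort_axs)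
  then have "wf_fm (A\<lparr>axs := X\<rparr>) \<phi> = wf_fm A \<phi>" for \<phi>
    by (induction \<phi>) simp_all
  then show ?thesis by (simp add: sentences_def)
qed

lemma fm_holds_axs: "fm_holds (A\<lparr>axs := X\<rparr>) \<sigma> \<phi> = fm_holds A \<sigma> \<phi>"
proof -
  have ev: "eval (A\<lparr>axs := X\<rparr>) \<sigma> t = eval A \<sigma> t" for \<sigma> t
    by (induction t) (simp_all cong: map_cong)
  then have "map (eval (A\<lparr>axs := X\<rparr>) \<sigma>) ts = map (eval A \<sigma>) ts" for \<sigma> ts
    by simp
  with ev have "atm_holds (A\<lparr>axs := X\<rparr>) \<sigma> a = atm_holds A \<sigma> a" for \<sigma> a
    by (cases a) (simp_all del: map_eq_conv)
  then show ?thesis by (induction \<phi> arbitrary: \<sigma>) simp_all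
qed

lemma axs_const_background:
  "axs (const_background I) =
    {\<phi> \<in> sentences (const_background I). \<forall>\<sigma>\<in>valuations (const_background I). fm_holds (const_background I) \<sigma> \<phi>}"
  unfolding const_background_def Let_def by (simp add: sentences_axs fm_holds_axs valuations_def del: background.update_convs)

lemma is_background_const: "is_background (const_background I)"
proof -
  let ?A = "const_background I"
  have "\<phi> \<in> axs ?A \<or> Neg \<phi> \<in> axs ?A" if "\<phi> \<in> sentences ?A" for \<phi>
  proof -
    \<comment> \<open>A sentence that fails under one valuation fails under all, so its negation is
      an axiom.\<close>
    have "fm_holds ?A \<sigma> \<phi> = fm_holds ?A \<tau> \<phi>" for \<sigma> \<tau>
      using that fm_holds_cong[of \<phi> \<sigma> \<tau> ?A] by (simp add: sentences_def)
    moreover have "Neg \<phi> \<in> sentences ?A" using that by (simp add: sentences_def)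
    ultimately show ?thesis using that unfolding axs_const_background
      by (cases "\<forall>\<sigma>\<in>valuations ?A. fm_holds ?A \<sigma> \<phi>") (simp_all, blast)
  qed
  moreover have "has_sort ?A (const n) 0" for n by (rule has_sort.intros) simp_all
  moreover have "axs ?A \<subseteq> sentences ?A" "\<forall>\<phi>\<in>axs ?A. \<forall>\<sigma>\<in>valuations ?A. fm_holds ?A \<sigma> \<phi>"
    unfolding axs_const_background by blast+
  ultimately show ?thesis
    unfolding is_background_def by simp
qed

section \<open>The CHC problem\<close>

definition word_rule :: "nat \<Rightarrow> (nat, nat, nat, nat) chc" where
  "word_rule r =
     CHC (Some (0, [(0, 0)])) (Conj [Lit True (Rel r [Var (0, 0), Var (1, 0)])]) (Some (0, [(1, 0)]))"

definition start :: "(nat, nat, nat, nat) chc" where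
  "start = CHC None (Conj [Lit True (Eq (Var (0, 0)) (const 0))]) (Some (0, [(0, 0)]))"

definition pred_sig :: "nat \<Rightarrow> nat list option" where
  "pred_sig p = (if p = 0 then Some [0] else None)"

text \<open>Indexing the rules by positions of the word ensures that each of them has a ground
  instance.\<close>

definition problem :: "(nat, nat, nat, nat) chc set" where
  "problem = insert start (range (\<lambda>n. word_rule (letter n)))"

lemma finite_problem: "finite problem"
proof -
  have "range (\<lambda>n. word_rule (letter n)) \<subseteq> word_rule ` {..<4}" using letter_less by auto
  then show ?thesis unfolding problem_def using finite_subset by blast
qed

lemma richer_refl: "richer A A"
  by (simp add: richer_def)

lemma recursive_iff_is_rule:
  assumes "is_chc A pred_sig \<phi>"
  shows "recursive \<phi> \<longleftrightarrow> is_rule \<phi>"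
  using assms by (auto simp: recursive_def is_rule_def is_chc_def wf_patom_def pred_sig_def split: if_splits)

lemma rule_shape:
  assumes "is_chc A pred_sig \<phi>" "is_rule \<phi>"
  shows "\<exists>xs ys. body \<phi> = Some (0, xs) \<and> head \<phi> = Some (0, ys)"
  using assms by (auto simp: is_rule_def is_chc_def wf_patom_def pred_sig_def split: if_splits)

section \<open>Ground instances in an arbitrary richer theory\<close>

context
  fixes A :: "(nat, nat, nat) background"
  assumes bg: "is_background A" and rich: "richer A word_theory"
begin

lemma sort_0: "0 \<in> sorts A"
  using rich by (simp add: richer_def word_theory_def)

lemma univ_0: "univ A 0 = range const"
  using rich by (simp add: richer_def word_theory_def)

lemma fun_type_rich: "fun_type A n = Some ([], 0)"
proof -
  have "fun_type word_theory n = Some ([], 0)" by (simp add: word_theory_def)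
  moreover have "fun_type word_theory \<subseteq>\<^sub>m fun_type A" using rich by (simp add: richer_def)
  ultimately show ?thesis by (metis domI map_le_def)
qed

lemma rel_type_rich: "rel_type A r = Some [0, 0]"
proof -
  have "rel_type word_theory r = Some [0, 0]" by (simp add: word_theory_def)
  moreover have "rel_type word_theory \<subseteq>\<^sub>m rel_type A" using rich by (simp add: richer_def)
  ultimately show ?thesis by (metis domI map_le_def)
qed

lemma fun_int_rich: "fun_int A n [] = const n"
proof -
  have "\<forall>f ss s ts. fun_type word_theory f = Some (ss, s) \<longrightarrow>
      list_all2 (\<lambda>t s. t \<in> univ word_theory s) ts ss \<longrightarrow> fun_int A f ts = fun_int word_theory f ts"
    using rich by (simp add: richer_def)
  from this[rule_format, of n "[]" 0 "[]"] show ?thesis by (simp add: word_theory_def)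
qed

lemma rel_int_rich: "t \<in> range const \<Longrightarrow> u \<in> range const \<Longrightarrow> rel_int A r [t, u] = rel_meaning r [t, u]"
proof -
  assume tu: "t \<in> range const" "u \<in> range const"
  have "\<forall>r ss ts. rel_type word_theory r = Some ss \<longrightarrow>
      list_all2 (\<lambda>t s. t \<in> univ word_theory s) ts ss \<longrightarrow> rel_int A r ts = rel_int word_theory r ts"
    using rich by (simp add: richer_def)
  from this[rule_format, of r "[0, 0]" "[t, u]"] tu show ?thesis by (simp add: word_theory_def)
qed

lemma is_chc_word_rule: "is_chc A pred_sig (word_rule r)"
  using sort_0
  by (auto simp: is_chc_def word_rule_def wf_patom_def pred_sig_def args_def rel_type_rich
      intro!: has_sort.intros)

lemma is_chc_start: "is_chc A pred_sig start"
  using sort_0 fun_type_rich[of 0]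
  by (auto simp: is_chc_def start_def wf_patom_def pred_sig_def args_def
      intro!: exI[of _ 0] has_sort.intros)

lemma valuation_exists:
  assumes "t \<in> range const" "u \<in> range const"
  shows "\<exists>\<sigma>\<in>valuations A. \<sigma> (0, 0 :: nat) = t \<and> \<sigma> (Suc 0, 0) = u"
proof -
  \<comment> \<open>A richer theory may have further sorts, so the remaining variables take
    arbitrary elements of their non-empty carriers.\<close>
  define \<sigma> where "\<sigma> v = (if v = (0, 0) then t else if v = (Suc 0, 0) then u else SOME x. x \<in> univ A (snd v))" for v
  have "univ A s \<noteq> {}" if "s \<in> sorts A" for s
    using bg that by (simp add: is_background_def)
  then have "\<sigma> \<in> valuations A"
    using assms by (auto simp: valuations_def \<sigma>_def univ_0 some_in_eq)
  then show ?thesis by (intro bexI[of _ \<sigma>]) (auto simp: \<sigma>_def)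
qed

lemma grnd_word_rule:
  "grnd A (word_rule r) =
    {(Some (0, [t]), Some (0, [u])) | t u. t \<in> range const \<and> u \<in> range const \<and> rel_meaning r [t, u]}"
proof -
  have "\<sigma> (0, 0) \<in> range const \<and> \<sigma> (Suc 0, 0) \<in> range const" if "\<sigma> \<in> valuations A" for \<sigma>
    using that sort_0 univ_0 by (auto simp: valuations_def)
  note range = this
  have "{(Some (0, [\<sigma> (0, 0)]), Some (0, [\<sigma> (Suc 0, 0)])) | \<sigma>.
      \<sigma> \<in> valuations A \<and> rel_int A r [\<sigma> (0, 0), \<sigma> (Suc 0, 0)]} =
    {(Some (0, [t]), Some (0, [u])) | t u. t \<in> range const \<and> u \<in> range const \<and> rel_meaning r [t, u]}"
    (is "?L = ?R")
  proof
    show "?L \<subseteq> ?R" using range rel_int_rich by auto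
    show "?R \<subseteq> ?L"
    proof
      fix e assume "e \<in> ?R"
      then obtain t u where e: "e = (Some (0, [t]), Some (0, [u]))" "t \<in> range const" "u \<in> range const"
        "rel_meaning r [t, u]" by blast
      then obtain \<sigma> where "\<sigma> \<in> valuations A" "\<sigma> (0, 0) = t" "\<sigma> (Suc 0, 0) = u"
        using valuation_exists by blast
      then show "e \<in> ?L" using e rel_int_rich by blast
    qed
  qed
  then show ?thesis unfolding grnd_def word_rule_def by simp
qed

lemma grnd_start: "grnd A start = {(None, at 0)}"
proof -
  obtain \<sigma> where "\<sigma> \<in> valuations A" "\<sigma> (0, 0) = const 0" using valuation_exists by blast
  then show ?thesis unfolding grnd_def start_def at_def by (auto simp: fun_int_rich intro: exI[of _ \<sigma>])
qed

text \<open>The only predicate is unary of sort 0, and a richer theory keeps the carrier of that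
  sort.\<close>

lemma grnd_rule_range:
  assumes "is_chc A pred_sig \<phi>" "is_rule \<phi>"
  shows "grnd A \<phi> \<subseteq> range at \<times> range at"
proof -
  obtain v w where "body \<phi> = Some (0, [v])" "head \<phi> = Some (0, [w])" "snd v = 0" "snd w = 0"
    using assms by (fastforce simp: is_rule_def is_chc_def wf_patom_def pred_sig_def split: if_splits)
  moreover from this have "\<sigma> v \<in> range const \<and> \<sigma> w \<in> range const" if "\<sigma> \<in> valuations A" for \<sigma>
    using that sort_0 univ_0 by (cases v; cases w) (auto simp: valuations_def)
  ultimately show ?thesis unfolding grnd_def at_def by auto
qed

end

lemma conjunctive_clauses: "conjunctive start" "conjunctive (word_rule r)"
  by (auto simp: conjunctive_def start_def word_rule_def)

lemma is_background_word_theory: "is_background word_theory"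
  by (simp add: word_theory_def is_background_const)

lemma transitive_closure_definable:
  fixes \<phi> :: "(nat, nat, nat, nat) chc"
  assumes "conjunctive \<phi>"
  shows "\<exists>r. \<forall>t u. rel_meaning r [t, u] \<longleftrightarrow>
    (Some (0, [t]), Some (0, [u])) \<in> (grnd word_theory \<phi>)\<^sup>+"
proof -
  obtain ls where ls: "cond \<phi> = Conj ls" "\<forall>l\<in>set ls. \<exists>b a. l = Lit b a"
    using assms by (auto simp: conjunctive_def)
  have "\<exists>N. \<forall>b r ts. Lit b (Rel r ts) \<in> set ls \<longrightarrow> r < N"
  proof (induction ls)
    case (Cons l ls)
    then obtain N where N: "\<forall>b r ts. Lit b (Rel r ts) \<in> set ls \<longrightarrow> r < N" by blast
    show ?case
    proof (cases "\<exists>b r ts. l = Lit b (Rel r ts)")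
      case True
      then obtain b r ts where "l = Lit b (Rel r ts)" by blast
      then show ?thesis using N by (intro exI[of _ "max N (Suc r)"]) fastforce
    next
      case False
      then show ?thesis using N by (intro exI[of _ N]) (metis set_ConsD)
    qed
  qed simp
  then obtain N where N: "\<And>b r ts. Lit b (Rel r ts) \<in> set ls \<Longrightarrow> r < N" by blast
  \<comment> \<open>The offset 4 skips the letters. Pairing with \<open>N\<close> pushes the code
    above every symbol in the condition, so the truncation in \<open>rel_meaning\<close> does not
    affect \<open>\<phi>\<close>.\<close>
  define r where "r = 4 + prod_encode (to_nat \<phi>, N)"
  have "N \<le> r" using le_prod_encode_2[of N "to_nat \<phi>"] by (simp add: r_def)
  then have "grnd (const_background (\<lambda>r'. if r' < r then rel_meaning r' else (\<lambda>_. False))) \<phi>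
      = grnd word_theory \<phi>"
    unfolding word_theory_def using N by (intro grnd_const_background_cong[OF ls]) fastforce
  moreover have "decode_chc r = \<phi>" by (simp add: decode_chc_def r_def)
  moreover have "\<not> r < 4" by (simp add: r_def)
  ultimately show ?thesis
    by (intro exI[of _ r] allI, subst rel_meaning.simps) simp
qed

text \<open>A recursive clause is accelerated to a single-literal rule whose relation symbol denotes
  the closure of its instances.\<close>

lemma acceleration_exists: "\<exists>accel. acceleration_technique word_theory pred_sig accel"
proof -
  define code where "code \<phi> = (SOME r. \<forall>t u. rel_meaning r [t, u] \<longleftrightarrow>
    (Some (0, [t]), Some (0, [u])) \<in> (grnd word_theory \<phi>)\<^sup>+)" for \<phi> :: "(nat, nat, nat, nat) chc"
  have code: "rel_meaning (code \<phi>) [t, u] \<longleftrightarrow> (Some (0, [t]), Some (0, [u])) \<in> (grnd word_theory \<phi>)\<^sup>+"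
    if "conjunctive \<phi>" for \<phi> t u
    using someI_ex[OF transitive_closure_definable[OF that]] unfolding code_def by blast
  note ctx = is_background_word_theory richer_refl[of word_theory]
  have "acceleration_technique word_theory pred_sig (\<lambda>\<phi>. word_rule (code \<phi>))"
    unfolding acceleration_technique_def
  proof (intro allI impI conjI; elim conjE)
    fix \<phi> :: "(nat, nat, nat, nat) chc"
    assume \<phi>: "is_chc word_theory pred_sig \<phi>" "recursive \<phi>" "conjunctive \<phi>"
    show "recursive (word_rule (code \<phi>))" by (simp add: recursive_def word_rule_def)
    have "grnd word_theory \<phi> \<subseteq> range at \<times> range at"
      using grnd_rule_range[OF ctx \<phi>(1)] \<phi>(2) recursive_iff_is_rule[OF \<phi>(1)] by simp
    \<comment> \<open>The symbol describes the closure only on pairs of unary atoms; this inclusion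
      shows that there are no other pairs.\<close>
    then have "(grnd word_theory \<phi>)\<^sup>+ \<subseteq> range at \<times> range at" by (rule trancl_subset_Sigma)
    then have "grnd word_theory (word_rule (code \<phi>)) = (grnd word_theory \<phi>)\<^sup>+"
      unfolding grnd_word_rule[OF ctx] code[OF \<phi>(3)] by (auto simp: at_def)
    then show "grnd word_theory (word_rule (code \<phi>)) =
        (\<Union>n\<in>{1..}. grnd word_theory (res_seq (replicate n \<phi>)))"
      using grnd_powers[OF \<phi>(1,3,2)] by simp
  qed (simp_all add: is_chc_word_rule[OF ctx] conjunctive_clauses)
  then show ?thesis by blast
qed


section \<open>Occurrences of factors\<close>

text \<open>A factor is represented by the position \<open>p\<close> of one of its occurrences and
  its length \<open>l\<close>, so it is a factor by construction and the relation is never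
  empty.\<close>

definition occs :: "nat \<Rightarrow> nat \<Rightarrow>
  ((nat \<times> (nat, nat var) tm list) option \<times> (nat \<times> (nat, nat var) tm list) option) set" where
  "occs p l = {(at n, at (n + l)) | n. \<forall>j<l. letter (n + j) = letter (p + j)}"

lemma mem_occs_iff:
  "(at n, at m) \<in> occs p l \<longleftrightarrow> m = n + l \<and> (\<forall>j<l. letter (n + j) = letter (p + j))"
  by (auto simp: occs_def)

lemma occsE:
  assumes "(b, h) \<in> occs p l"
  obtains n where "b = at n" "h = at (n + l)" "\<forall>j<l. letter (n + j) = letter (p + j)"
  using assms by (auto simp: occs_def)

lemma occs_occurrence: "(at n, at m) \<in> occs p l \<Longrightarrow> occs p l = occs n l"
  by (auto simp: occs_def)

text \<open>Composition concatenates factors. The hypotheses provide a place \<open>n\<close> where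
  the concatenation occurs, which becomes its representative.\<close>

lemma occs_relcomp:
  assumes "(at n, at m) \<in> occs p l" "(at m, at k) \<in> occs q l'"
  shows "occs p l O occs q l' = occs n (l + l')"
proof -
  have m: "m = n + l" "\<forall>j<l. letter (n + j) = letter (p + j)"
    and k: "k = m + l'" "\<forall>j<l'. letter (m + j) = letter (q + j)"
    using assms by (simp_all add: mem_occs_iff)
  have split: "(\<forall>j<l + l'. letter (i + j) = letter (n + j)) \<longleftrightarrow>
      (\<forall>j<l. letter (i + j) = letter (n + j)) \<and> (\<forall>j<l'. letter (i + l + j) = letter (n + l + j))" for i
  proof (intro iffI conjI allI impI)
    fix j assume *: "(\<forall>j<l. letter (i + j) = letter (n + j)) \<and> (\<forall>j<l'. letter (i + l + j) = letter (n + l + j))"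
      "j < l + l'"
    show "letter (i + j) = letter (n + j)"
    proof (cases "j < l")
      case False
      then have "j - l < l'" "i + j = i + l + (j - l)" "n + j = n + l + (j - l)" using *(2) by auto
      then show ?thesis using *(1) by metis
    qed (use * in blast)
  next
    fix j assume *: "\<forall>j<l + l'. letter (i + j) = letter (n + j)" "j < l'"
    then show "letter (i + l + j) = letter (n + l + j)"
      using spec[OF *(1), of "l + j"] by (simp add: add.assoc)
  qed auto
  have "occs p l O occs q l' =
      {(at i, at (i + l + l')) | i. (\<forall>j<l. letter (i + j) = letter (p + j)) \<and>
        (\<forall>j<l'. letter (i + l + j) = letter (q + j))}"
    unfolding occs_def by auto
  also have "\<dots> = occs n (l + l')"
    unfolding occs_def split using m k by (simp add: add.assoc)
  finally show ?thesis .
qed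

lemma occs_image: "{(b, at n)} O occs n l = {(b, at (n + l))}"
proof -
  have "(at n, h) \<in> occs n l \<longleftrightarrow> h = at (n + l)" for h
    by (cases "\<exists>m. h = at m") (auto simp: mem_occs_iff elim: occsE)
  then show ?thesis by auto
qed

text \<open>Two consecutive edges of the same factor would spell a square.\<close>

lemma occs_no_square:
  assumes "0 < l" "(at n, at m) \<in> occs p l"
  shows "(at m, h) \<notin> occs p l"
proof
  assume "(at m, h) \<in> occs p l"
  then have "\<forall>j<l. letter (n + j) = letter (n + l + j)"
    using assms(2) by (auto simp: occs_def)
  then show False using letter_square_free[OF assms(1)] by metis
qed

text \<open>No two edges compose, so transitivity holds vacuously.\<close>

lemma trancl_occs:
  assumes "0 < l"
  shows "(occs p l)\<^sup>+ = occs p l"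
proof (rule trancl_id)
  have False if "(x, y) \<in> occs p l" "(y, z) \<in> occs p l" for x y z
    using that(1)
  proof (rule occsE)
    fix n assume "x = at n" "y = at (n + l)"
    then show False using occs_no_square[OF assms] that by metis
  qed
  then show "trans (occs p l)" by (auto simp: trans_def)
qed

text \<open>One common edge fixes the length and then the letters. Hence redundancy between clauses
  that spell factors is never strict.\<close>

lemma occs_subset:
  assumes "(at n, at m) \<in> occs p l" "occs p l \<subseteq> occs q l'"
  shows "occs p l = occs q l'"
proof -
  have "(at n, at m) \<in> occs q l'" using assms by blast
  moreover have "l = l'" using assms(1) calculation by (simp add: mem_occs_iff)
  ultimately show ?thesis using occs_occurrence assms(1) by metis
qed

section \<open>Derivations\<close>

context
  fixes A :: "(nat, nat, nat) background"
    and accel :: "(nat, nat, nat, nat) chc \<Rightarrow> (nat, nat, nat, nat) chc"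
  assumes bg: "is_background A" and rich: "richer A word_theory"
    and acc: "acceleration_technique A pred_sig accel"
begin

text \<open>The form of all clauses other than the fact. It persists under acceleration and under
  resolution along a path; being conjunctive makes a clause its own implicant.\<close>

definition word_clause :: "(nat, nat, nat, nat) chc \<Rightarrow> bool" where
  "word_clause \<phi> \<longleftrightarrow> is_chc A pred_sig \<phi> \<and> conjunctive \<phi> \<and> is_rule \<phi> \<and>
     (\<exists>p l. 0 < l \<and> grnd A \<phi> = occs p l)"

lemma word_clause_shape:
  assumes "word_clause \<phi>"
  shows "is_chc A pred_sig \<phi> \<and> conjunctive \<phi> \<and> (\<exists>xs ys. body \<phi> = Some (0, xs) \<and> head \<phi> = Some (0, ys))"
  using assms rule_shape by (auto simp: word_clause_def)

lemma word_clause_edge: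
  assumes "word_clause \<phi>" "(at n, at m) \<in> grnd A \<phi>"
  obtains l where "0 < l" "m = n + l" "grnd A \<phi> = occs n l"
proof -
  obtain p l where "0 < l" "grnd A \<phi> = occs p l" using assms(1) by (auto simp: word_clause_def)
  then show ?thesis using that assms(2) occs_occurrence mem_occs_iff by metis
qed

lemma word_clause_grndE:
  assumes "word_clause \<phi>" "(b, h) \<in> grnd A \<phi>"
  obtains n m where "b = at n" "h = at m"
  using assms by (auto simp: word_clause_def elim!: occsE)

lemma word_clause_deterministic:
  "word_clause \<phi> \<Longrightarrow> (at n, at m) \<in> grnd A \<phi> \<Longrightarrow> (at n, at m') \<in> grnd A \<phi> \<Longrightarrow> m = m'"
  by (auto simp: word_clause_def mem_occs_iff)

lemma word_clause_increasing:
  "word_clause \<phi> \<Longrightarrow> (at n, at m) \<in> grnd A \<phi> \<Longrightarrow> n < m"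
  by (auto simp: word_clause_def mem_occs_iff)

lemma word_clause_word_rule: "word_clause (word_rule (letter n))"
proof -
  have "grnd A (word_rule (letter n)) = occs n 1"
    unfolding grnd_word_rule[OF bg rich] occs_def
    by (subst rel_meaning.simps) (auto simp: letter_less at_def)
  then show ?thesis
    using is_chc_word_rule[OF bg rich] conjunctive_clauses
    by (auto simp: word_clause_def is_rule_def word_rule_def)
qed

lemma word_rule_edge: "(at n, at (Suc n)) \<in> grnd A (word_rule (letter n))"
  unfolding grnd_word_rule[OF bg rich]
  by (subst rel_meaning.simps) (auto simp: letter_less at_def)

section \<open>Traces as paths through the positions of the word\<close>

definition path :: "(nat \<Rightarrow> nat) \<Rightarrow> (nat, nat, nat, nat) chc list \<Rightarrow> bool" where
  "path pos us \<longleftrightarrow> (\<forall>i<length us. (at (pos i), at (pos (Suc i))) \<in> grnd A (us ! i))"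

lemma path_snoc:
  "path pos (us @ [u]) \<longleftrightarrow>
    path pos us \<and> (at (pos (length us)), at (pos (Suc (length us)))) \<in> grnd A u"
  by (auto simp: path_def nth_append less_Suc_eq)

lemma path_append:
  "path pos (us @ vs) \<longleftrightarrow> path pos us \<and> path (\<lambda>i. pos (length us + i)) vs"
proof (induction vs rule: rev_induct)
  case (snoc v vs)
  then show ?case
    using path_snoc[of pos "us @ vs" v] path_snoc[of "\<lambda>i. pos (length us + i)" vs v] by auto
qed (simp add: path_def)

lemma path_cong: "(\<And>i. i \<le> length us \<Longrightarrow> pos i = pos' i) \<Longrightarrow> path pos us = path pos' us"
  by (auto simp: path_def)

lemma path_increasing:
  assumes "path pos us" "\<forall>u\<in>set us. word_clause u" "us \<noteq> []"
  shows "pos 0 < pos (length us)"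
  using assms(3,1,2)
proof (induction us rule: rev_nonempty_induct)
  case (single u)
  then show ?case using word_clause_increasing by (simp add: path_def)
next
  case (snoc u us)
  then show ?case using word_clause_increasing by (fastforce simp: path_snoc)
qed

text \<open>The path itself shows that the spelled factors occur side by side, starting at
  \<open>pos 0\<close>, as \<open>occs_relcomp\<close> requires.\<close>

lemma path_res_seq:
  assumes "path pos us" "\<forall>u\<in>set us. word_clause u" "us \<noteq> []"
  shows "word_clause (res_seq us) \<and> (at (pos 0), at (pos (length us))) \<in> grnd A (res_seq us)"
  using assms(3,1,2)
proof (induction us rule: rev_nonempty_induct)
  case (single u)
  then show ?case by (simp add: path_def)
next
  case (snoc u us)
  then have IH: "word_clause (res_seq us)" "(at (pos 0), at (pos (length us))) \<in> grnd A (res_seq us)"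
    and u: "word_clause u" "(at (pos (length us)), at (pos (Suc (length us)))) \<in> grnd A u"
    by (auto simp: path_snoc)
  have shapes: "\<And>\<phi>. \<phi> \<in> set (us @ [u]) \<Longrightarrow>
      is_chc A pred_sig \<phi> \<and> conjunctive \<phi> \<and> (\<exists>xs ys. body \<phi> = Some (0, xs) \<and> head \<phi> = Some (0, ys))"
    using snoc.prems word_clause_shape by blast
  have grnd: "grnd A (res_seq (us @ [u])) = grnd A (res_seq us) O grnd A u"
    by (rule grnd_res_seq_snoc[OF snoc.hyps(1) shapes])
  obtain l l' where "0 < l" "grnd A (res_seq us) = occs (pos 0) l" "grnd A u = occs (pos (length us)) l'"
    using word_clause_edge[OF IH] word_clause_edge[OF u] by metis
  then have "\<exists>p l. 0 < l \<and> grnd A (res_seq (us @ [u])) = occs p l"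
    using grnd occs_relcomp IH(2) u(2) by (metis add_gr_0)
  then have "word_clause (res_seq (us @ [u]))"
    using res_seq_recursive[OF _ shapes, of "us @ [u]"] by (auto simp: word_clause_def is_rule_def)
  then show ?case using grnd IH(2) u(2) by auto
qed

text \<open>The fact has one ground instance and each rule continues it in one way only, so the
  instance of the whole trace is determined by the position reached.\<close>

lemma trace_res_seq:
  assumes "path pos us" "\<forall>u\<in>set us. word_clause u" "pos 0 = 0"
  shows "is_chc A pred_sig (res_seq (start # us)) \<and> (\<exists>xs. head (res_seq (start # us)) = Some (0, xs)) \<and>
    grnd A (res_seq (start # us)) = {(None, at (pos (length us)))}"
  using assms
proof (induction us rule: rev_induct)
  case Nil
  then show ?case using is_chc_start[OF bg rich] grnd_start[OF bg rich] by (simp add: start_def)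
next
  case (snoc u us)
  let ?t = "res_seq (start # us)"
  obtain xs where t: "is_chc A pred_sig ?t" "head ?t = Some (0, xs)"
    "grnd A ?t = {(None, at (pos (length us)))}"
    using snoc by (auto simp: path_snoc)
  have u: "word_clause u" "(at (pos (length us)), at (pos (Suc (length us)))) \<in> grnd A u"
    using snoc.prems by (auto simp: path_snoc)
  obtain ys zs where s: "is_chc A pred_sig u" "body u = Some (0, ys)" "head u = Some (0, zs)"
    using word_clause_shape[OF u(1)] by blast
  have "res_seq (start # us @ [u]) = res ?t u" using res_seq_snoc[of "start # us" u] by simp
  moreover obtain l where "pos (Suc (length us)) = pos (length us) + l" "grnd A u = occs (pos (length us)) l"
    using word_clause_edge[OF u] .
  then have "grnd A ?t O grnd A u = {(None, at (pos (Suc (length us))))}"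
    by (simp only: t(3) occs_image)
  ultimately show ?case
    using is_chc_res[OF t(1) s(1) t(2) s(2)] head_res[OF t(1) s(1) t(2) s(2)]
      grnd_res[OF t(1) s(1) t(2) s(2)] s(3) by simp
qed

lemma active_rule_iff:
  assumes "path pos us" "\<forall>u\<in>set us. word_clause u" "pos 0 = 0" "word_clause \<psi>"
  shows "active A (start # us) Bs \<psi> \<longleftrightarrow>
    \<not> redundant A \<psi> (last Bs) \<and> (\<exists>m. (at (pos (length us)), at m) \<in> grnd A \<psi>)"
proof -
  let ?t = "res_seq (start # us)"
  obtain xs where t: "is_chc A pred_sig ?t" "head ?t = Some (0, xs)"
    "grnd A ?t = {(None, at (pos (length us)))}"
    using trace_res_seq[OF assms(1-3)] by blast
  obtain ys where s: "is_chc A pred_sig \<psi>" "body \<psi> = Some (0, ys)"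
    using word_clause_shape[OF assms(4)] by blast
  have "res_seq ((start # us) @ [\<psi>]) = res ?t \<psi>" by (rule res_seq_snoc) simp
  then have "grnd A (res_seq ((start # us) @ [\<psi>])) = {(None, at (pos (length us)))} O grnd A \<psi>"
    using grnd_res[OF t(1) s(1) t(2) s(2)] t(3) by simp
  then have "cond_satisfiable A (res_seq ((start # us) @ [\<psi>])) \<longleftrightarrow>
      (\<exists>h. (at (pos (length us)), h) \<in> grnd A \<psi>)"
    by (auto simp: cond_satisfiable_iff_grnd)
  then show ?thesis
    unfolding active_def using word_clause_grndE[OF assms(4)] by metis
qed

text \<open>The fact has no body atom to resolve with, so the result is the default clause.\<close>

lemma start_inactive: "\<not> active A (start # us) Bs start"
proof -
  have "res_seq ((start # us) @ [start]) = res (res_seq (start # us)) start"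
    by (rule res_seq_snoc) simp
  moreover have "res \<phi> start = CHC None (Disj []) None" for \<phi>
    by (simp add: res_def rename_apart_def rename_chc_def start_def Let_def split: option.splits prod.splits)
  ultimately show ?thesis by (simp add: active_def cond_satisfiable_def)
qed

text \<open>
  Whatever is blocked at a position of the trace is superseded by a clause that starts at the same
  or an earlier position and leads at least as far. So a clause leading as far as possible from
  the initial position is never blocked.
\<close>

definition superseded :: "(nat, nat, nat, nat) chc set \<Rightarrow> (nat \<Rightarrow> nat) \<Rightarrow> nat \<Rightarrow> nat \<Rightarrow> bool" where
  "superseded \<Pi> pos i m \<longleftrightarrow>
     (\<exists>j\<le>i. \<exists>x\<in>\<Pi>. \<exists>m'. (at (pos j), at m') \<in> grnd A x \<and> (j < i \<and> m \<le> m' \<or> m < m'))"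

definition blocks_ok ::
  "(nat, nat, nat, nat) chc set \<Rightarrow> (nat \<Rightarrow> nat) \<Rightarrow> nat \<Rightarrow> (nat, nat, nat, nat) chc set \<Rightarrow> bool" where
  "blocks_ok \<Pi> pos i C \<longleftrightarrow>
     (\<forall>v\<in>C. \<forall>m. (at (pos i), at m) \<in> grnd A v \<longrightarrow> superseded \<Pi> pos i m)"

definition clauses_ok :: "(nat, nat, nat, nat) chc set \<Rightarrow> bool" where
  "clauses_ok \<Pi> \<longleftrightarrow> finite \<Pi> \<and> problem \<subseteq> \<Pi> \<and> (\<forall>\<phi>\<in>\<Pi>. \<phi> = start \<or> word_clause \<phi>)"

text \<open>\<open>us\<close> is the trace without the fact and \<open>Cs\<close> the list of
  blocking sets without the first one. Thus \<open>Cs ! i\<close> belongs to the state after the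
  fact and \<open>i\<close> rules, which explains the lengths.\<close>

definition trace_ok ::
  "(nat, nat, nat, nat) chc set \<Rightarrow> (nat \<Rightarrow> nat) \<Rightarrow> (nat, nat, nat, nat) chc list
   \<Rightarrow> (nat, nat, nat, nat) chc set list \<Rightarrow> bool" where
  "trace_ok \<Pi> pos us Cs \<longleftrightarrow>
     path pos us \<and> pos 0 = 0 \<and> set us \<subseteq> \<Pi> \<and> (\<forall>u\<in>set us. word_clause u) \<and>
     length Cs = Suc (length us) \<and> (\<forall>i\<le>length us. blocks_ok \<Pi> pos i (Cs ! i))"

text \<open>With an empty trace, the only blocking set is still empty: once the fact is on the
  trace, it is never removed and hence never blocked there.\<close>

fun config_ok :: "(nat, nat, nat, nat) config \<Rightarrow> bool" where
  "config_ok (Start \<Phi>) \<longleftrightarrow> \<Phi> = problem"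
| "config_ok (State \<Pi> \<phi>s Bs L) \<longleftrightarrow> clauses_ok \<Pi> \<and>
     (\<phi>s = [] \<and> Bs = [{}] \<or>
      (\<exists>us B Cs pos. \<phi>s = start # us \<and> Bs = B # Cs \<and> trace_ok \<Pi> pos us Cs))"
| "config_ok Unsat \<longleftrightarrow> True"
| "config_ok Sat \<longleftrightarrow> False"

lemma sip_clauses:
  assumes "clauses_ok \<Pi>"
  shows "sip A \<Pi> = {\<phi> \<in> \<Pi>. grnd A \<phi> \<noteq> {}}"
proof -
  have "conjunctive \<phi>" if "\<phi> \<in> \<Pi>" for \<phi>
    using assms that conjunctive_clauses by (auto simp: clauses_ok_def word_clause_def)
  then have "sip_chc A \<phi> = (if grnd A \<phi> \<noteq> {} then {\<phi>} else {})" if "\<phi> \<in> \<Pi>" for \<phi>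
    using that by (simp add: sip_chc_conjunctive cond_satisfiable_iff_grnd)
  then show ?thesis unfolding sip_def by (auto split: if_splits)
qed

lemma start_in_sip:
  assumes "clauses_ok \<Pi>"
  shows "start \<in> sip A \<Pi>"
  using assms by (auto simp: sip_clauses grnd_start[OF bg rich] clauses_ok_def problem_def)

lemma start_active: "active A [] [{}] start"
  by (simp add: active_def redundant_def cond_satisfiable_iff_grnd grnd_start[OF bg rich])

text \<open>Here square-freeness meets acceleration: the closure that any technique has to produce
  is the given relation itself.\<close>

lemma accel_word_clause:
  assumes "word_clause \<phi>"
  shows "word_clause (accel \<phi>) \<and> grnd A (accel \<phi>) = grnd A \<phi>"
proof -
  have \<phi>: "is_chc A pred_sig \<phi>" "conjunctive \<phi>" "is_rule \<phi>" "recursive \<phi>"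
    using assms recursive_iff_is_rule by (auto simp: word_clause_def)
  then have a: "is_chc A pred_sig (accel \<phi>)" "recursive (accel \<phi>)" "conjunctive (accel \<phi>)"
    "grnd A (accel \<phi>) = (grnd A \<phi>)\<^sup>+"
    using acc grnd_powers[OF \<phi>(1,2,4)] by (simp_all add: acceleration_technique_def)
  then have "grnd A (accel \<phi>) = grnd A \<phi>"
    using assms trancl_occs by (auto simp: word_clause_def)
  then show ?thesis
    using a assms recursive_iff_is_rule[OF a(1)] by (auto simp: word_clause_def)
qed

lemma superseded_mono: "superseded \<Pi> pos i m \<Longrightarrow> \<Pi> \<subseteq> \<Pi>' \<Longrightarrow> superseded \<Pi>' pos i m"
  unfolding superseded_def by blast

lemma superseded_cong:
  "(\<And>j. j \<le> i \<Longrightarrow> pos j = pos' j) \<Longrightarrow> superseded \<Pi> pos i m = superseded \<Pi> pos' i m"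
  unfolding superseded_def by (metis (no_types, lifting))

lemma blocks_ok_mono:
  assumes "blocks_ok \<Pi> pos i C" "\<Pi> \<subseteq> \<Pi>'" "\<And>j. j \<le> i \<Longrightarrow> pos j = pos' j"
  shows "blocks_ok \<Pi>' pos' i C"
  using assms superseded_mono superseded_cong[of i pos pos'] unfolding blocks_ok_def by (metis order_refl)

section \<open>Preservation of the invariant\<close>

lemma step_ok:
  assumes "clauses_ok \<Pi>" "trace_ok \<Pi> pos us Cs" "\<psi> \<in> sip A \<Pi>" "active A (start # us) (B # Cs) \<psi>"
  shows "\<exists>pos. trace_ok \<Pi> pos (us @ [\<psi>]) (Cs @ [{}])"
proof -
  have \<psi>: "\<psi> \<in> \<Pi>" "word_clause \<psi>"
    using assms(1,3,4) start_inactive by (auto simp: sip_clauses clauses_ok_def)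
  have t: "path pos us" "\<forall>u\<in>set us. word_clause u" "pos 0 = 0" "length Cs = Suc (length us)"
    using assms(2) by (auto simp: trace_ok_def)
  obtain m where m: "(at (pos (length us)), at m) \<in> grnd A \<psi>"
    using assms(4) active_rule_iff[OF t(1-3) \<psi>(2)] by blast
  let ?pos = "pos(Suc (length us) := m)"
  have "path ?pos us" using t(1) path_cong[of us pos ?pos] by simp
  then have "path ?pos (us @ [\<psi>])" using m by (simp add: path_snoc)
  moreover have "blocks_ok \<Pi> ?pos i ((Cs @ [{}]) ! i)" if "i \<le> Suc (length us)" for i
  proof (cases "i = Suc (length us)")
    case True
    then show ?thesis using t(4) by (simp add: blocks_ok_def nth_append)
  next
    case False
    then have i: "i \<le> length us" using that by simp
    then have "blocks_ok \<Pi> pos i (Cs ! i)" using assms(2) by (simp add: trace_ok_def)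
    then have "blocks_ok \<Pi> ?pos i (Cs ! i)" by (rule blocks_ok_mono) (use i in auto)
    then show ?thesis using i t(4) by (simp add: nth_append)
  qed
  ultimately have "trace_ok \<Pi> ?pos (us @ [\<psi>]) (Cs @ [{}])"
    using assms(2) \<psi> by (simp add: trace_ok_def)
  then show ?thesis by blast
qed

lemma accelerate_ok:
  assumes "clauses_ok \<Pi>" "trace_ok \<Pi> pos (us @ vs) (Cs @ Ds)" "vs \<noteq> []" "length vs = length Ds"
  defines "\<phi> \<equiv> accel (res_seq vs)"
  shows "clauses_ok (insert \<phi> \<Pi>)" "\<exists>pos. trace_ok (insert \<phi> \<Pi>) pos (us @ [\<phi>]) (Cs @ [{\<phi>}])"
proof -
  let ?k = "length us"
  have t: "path pos (us @ vs)" "\<forall>u\<in>set (us @ vs). word_clause u" "pos 0 = 0" "length Cs = Suc ?k"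
    using assms(2,4) by (auto simp: trace_ok_def)
  have p: "path pos us" "path (\<lambda>i. pos (?k + i)) vs" using t(1) by (simp_all add: path_append)
  have "word_clause (res_seq vs)" "(at (pos ?k), at (pos (?k + length vs))) \<in> grnd A (res_seq vs)"
    using path_res_seq[OF p(2)] t(2) assms(3) by simp_all
  then have \<phi>: "word_clause \<phi>" "(at (pos ?k), at (pos (?k + length vs))) \<in> grnd A \<phi>"
    using accel_word_clause unfolding \<phi>_def by auto
  show "clauses_ok (insert \<phi> \<Pi>)" using assms(1) \<phi>(1) by (auto simp: clauses_ok_def)
  \<comment> \<open>The learned clause leads from the start of the accelerated suffix directly to
    its end.\<close>
  let ?pos = "pos(Suc ?k := pos (?k + length vs))"
  have "path ?pos us" using p(1) path_cong[of us pos ?pos] by simp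
  then have "path ?pos (us @ [\<phi>])" using \<phi>(2) by (simp add: path_snoc)
  moreover have "blocks_ok (insert \<phi> \<Pi>) ?pos i ((Cs @ [{\<phi>}]) ! i)" if "i \<le> Suc ?k" for i
  proof (cases "i = Suc ?k")
    case True
    \<comment> \<open>The new blocking set contains \<open>\<phi>\<close>, which is harmless:
      applying \<open>\<phi>\<close> again at its own end would yield a square.\<close>
    have "(at (pos (?k + length vs)), at m) \<notin> grnd A \<phi>" for m
      using \<phi> occs_no_square by (auto simp: word_clause_def)
    then show ?thesis using t(4) True by (simp add: blocks_ok_def nth_append)
  next
    case False
    then have i: "i \<le> ?k" using that by simp
    then have "blocks_ok \<Pi> pos i ((Cs @ Ds) ! i)" using assms(2) by (simp add: trace_ok_def)
    then have "blocks_ok \<Pi> pos i (Cs ! i)" using i t(4) by (simp add: nth_append)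
    then have "blocks_ok (insert \<phi> \<Pi>) ?pos i (Cs ! i)" by (rule blocks_ok_mono) (use i in auto)
    then show ?thesis using i t(4) by (simp add: nth_append)
  qed
  ultimately have "trace_ok (insert \<phi> \<Pi>) ?pos (us @ [\<phi>]) (Cs @ [{\<phi>}])"
    using assms(2) \<phi>(1) t(4) by (auto simp: trace_ok_def)
  then show "\<exists>pos. trace_ok (insert \<phi> \<Pi>) pos (us @ [\<phi>]) (Cs @ [{\<phi>}])" by blast
qed

text \<open>The removed clause becomes blocked where it started. It has only one edge there, so it
  suffices that this edge is superseded.\<close>

lemma bt_ok:
  assumes "trace_ok \<Pi> pos (us @ [u]) Cs" "superseded \<Pi> pos (length us) (pos (Suc (length us)))"
    and "clauses_ok \<Pi>"
  shows "config_ok (bt (State \<Pi> (start # us @ [u]) (B # Cs) L))"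
proof -
  have l: "length Cs = Suc (Suc (length us))" using assms(1) by (simp add: trace_ok_def)
  obtain Cs' C D where Cs: "Cs = Cs' @ [C, D]"
  proof -
    obtain Xs D where "Cs = Xs @ [D]" using l by (metis list.size(3) nat.distinct(1) rev_exhaust)
    moreover from this l obtain Cs' C where "Xs = Cs' @ [C]"
      by (metis Suc_inject length_append_singleton list.size(3) nat.distinct(1) rev_exhaust)
    ultimately show ?thesis using that by simp
  qed
  have t: "path pos us" "word_clause u" "(at (pos (length us)), at (pos (Suc (length us)))) \<in> grnd A u"
    using assms(1) by (auto simp: trace_ok_def path_snoc)
  have "blocks_ok \<Pi> pos i ((Cs' @ [insert u C]) ! i)" if "i \<le> length us" for i
  proof -
    have old: "blocks_ok \<Pi> pos i ((Cs' @ [C, D]) ! i)" using assms(1) that Cs by (simp add: trace_ok_def)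
    show ?thesis
    proof (cases "i = length us")
      case True
      have "superseded \<Pi> pos i m" if "(at (pos i), at m) \<in> grnd A u" for m
        using word_clause_deterministic[OF t(2)] t(3) that True assms(2) by metis
      then show ?thesis using old True l Cs by (auto simp: blocks_ok_def nth_append)
    next
      case False
      then show ?thesis using old that l Cs by (auto simp: nth_append)
    qed
  qed
  then have "trace_ok \<Pi> pos us (Cs' @ [insert u C])"
    using assms(1) t(1) l Cs by (auto simp: trace_ok_def)
  moreover have "bt (State \<Pi> (start # us @ [u]) (B # Cs) L) = State \<Pi> (start # us) (B # Cs' @ [insert u C]) L"
    by (simp add: Cs butlast_append)
  ultimately show ?thesis using assms(3) by auto
qed

text \<open>Inclusions between factor relations are equalities, so the covered suffix has at least
  two elements. The covering clause spans it from its start, earlier than the last clause, and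
  reaches the same end.\<close>

lemma covered_superseded:
  assumes "clauses_ok \<Pi>" "trace_ok \<Pi> pos us Cs" "covered A \<Pi> vs" "start # us = ws @ vs"
  obtains us' u where "us = us' @ [u]" "superseded \<Pi> pos (length us') (pos (Suc (length us')))"
proof -
  have t: "path pos us" "\<forall>u\<in>set us. word_clause u" "pos 0 = 0"
    using assms(2) by (auto simp: trace_ok_def)
  have c: "vs \<noteq> []" "strictly_redundant A (res_seq vs) (sip A \<Pi>) \<or>
      redundant A (res_seq vs) (sip A \<Pi>) \<and> length vs > 1"
    using assms(3) by (auto simp: covered_def)
  then obtain x where x: "x \<in> \<Pi>" "grnd A (res_seq vs) \<subseteq> grnd A x"
    "grnd A (res_seq vs) \<noteq> grnd A x \<or> length vs > 1"
    unfolding strictly_redundant_def redundant_def sip_clauses[OF assms(1)] by blast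
  have x_cases: "x = start \<or> word_clause x" using x(1) assms(1) by (auto simp: clauses_ok_def)
  show ?thesis
  proof (cases ws)
    \<comment> \<open>If the suffix contained the fact, only the fact could cover it. Positions
      increase along the path, so the suffix would be the fact alone, which is too short and not
      strictly covered.\<close>
    case Nil
    then have vs: "vs = start # us" using assms(4) by simp
    have g: "grnd A (res_seq vs) = {(None, at (pos (length us)))}"
      using trace_res_seq[OF t] vs by simp
    then have "x = start"
      using x(2) x_cases word_clause_grndE[of x None "at (pos (length us))"] by auto
    then have "pos (length us) = 0" "grnd A (res_seq vs) = grnd A x"
      using g x(2) grnd_start[OF bg rich] by auto
    then have "us = []" "length vs > 1" using path_increasing[OF t(1,2)] t(3) x(3) by auto
    then show ?thesis using vs by simp
  next
    case (Cons w ws')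
    then have us: "us = ws' @ vs" using assms(4) by simp
    let ?k = "length ws'"
    have p: "path (\<lambda>i. pos (?k + i)) vs" using t(1) us by (simp add: path_append)
    have r: "word_clause (res_seq vs)" "(at (pos ?k), at (pos (?k + length vs))) \<in> grnd A (res_seq vs)"
      using path_res_seq[OF p] t(2) us c(1) by simp_all
    then have "word_clause x"
      using x(2) x_cases grnd_start[OF bg rich] by auto
    then have "grnd A (res_seq vs) = grnd A x"
      using r x(2) occs_subset unfolding word_clause_def by metis
    then have len: "length vs > 1" using x(3) by simp
    obtain vs' u where vs: "vs = vs' @ [u]" using c(1) by (metis rev_exhaust)
    have "superseded \<Pi> pos (length (ws' @ vs')) (pos (Suc (length (ws' @ vs'))))"
      unfolding superseded_def
      by (intro exI[of _ ?k] bexI[of _ x] exI[of _ "pos (?k + length vs)"] conjI disjI1)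
        (use r(2) x len vs in auto)
    then show ?thesis using that[of "ws' @ vs'" u] us vs by simp
  qed
qed

text \<open>A clause reaching furthest from the end of the trace is inactive, hence blocked and
  superseded. By maximality, its rival starts strictly earlier; so a rule follows the fact, and the
  rival also supersedes the last rule.\<close>

lemma backtrack_superseded:
  assumes "clauses_ok \<Pi>" "trace_ok \<Pi> pos us Cs"
    and inactive: "\<forall>\<psi>\<in>sip A \<Pi>. is_rule \<psi> \<or> is_query \<psi> \<longrightarrow> \<not> active A (start # us) (B # Cs) \<psi>"
  obtains us' u where "us = us' @ [u]" "superseded \<Pi> pos (length us') (pos (Suc (length us')))"
proof -
  let ?k = "length us"
  have t: "path pos us" "\<forall>u\<in>set us. word_clause u" "pos 0 = 0" "length Cs = Suc ?k"
    using assms(2) by (auto simp: trace_ok_def)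
  have edge: "word_clause x" if "x \<in> \<Pi>" "(at n, at m) \<in> grnd A x" for x n m
    using assms(1) that grnd_start[OF bg rich] by (auto simp: clauses_ok_def)
  \<comment> \<open>The ends of all edges leaving the current position: finite, since each clause
    contributes at most one, and non-empty, since the rule for the next letter is always
    present.\<close>
  define M where "M = {m. \<exists>x\<in>\<Pi>. (at (pos ?k), at m) \<in> grnd A x}"
  have "finite (\<Union>x\<in>\<Pi>. {m. (at (pos ?k), at m) \<in> grnd A x})"
  proof (rule finite_UN_I)
    show "finite \<Pi>" using assms(1) by (simp add: clauses_ok_def)
    show "finite {m. (at (pos ?k), at m) \<in> grnd A x}" if "x \<in> \<Pi>" for x
    proof (rule finite_subset)
      show "{m. (at (pos ?k), at m) \<in> grnd A x} \<subseteq> {THE m. (at (pos ?k), at m) \<in> grnd A x}"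
        using word_clause_deterministic[OF edge[OF that]] by (auto intro!: the_equality[symmetric])
    qed simp
  qed
  then have fin: "finite M" by (simp add: M_def UNION_eq)
  have "word_rule (letter (pos ?k)) \<in> \<Pi>" using assms(1) by (auto simp: clauses_ok_def problem_def)
  then have "Suc (pos ?k) \<in> M" using word_rule_edge unfolding M_def by blast
  then have "Max M \<in> M" using fin by (intro Max_in) auto
  then obtain x where x: "x \<in> \<Pi>" "(at (pos ?k), at (Max M)) \<in> grnd A x" unfolding M_def by blast
  have wx: "word_clause x" using edge x by blast
  have "x \<in> sip A \<Pi>" using x assms(1) by (auto simp: sip_clauses)
  then have "\<not> active A (start # us) (B # Cs) x" using inactive wx by (simp add: word_clause_def)
  then have "redundant A x (last Cs)"
    using active_rule_iff[OF t(1-3) wx] x(2) t(4) by (auto split: if_splits)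
  then obtain v where v: "v \<in> last Cs" "(at (pos ?k), at (Max M)) \<in> grnd A v"
    using x(2) by (auto simp: redundant_def)
  have "last Cs = Cs ! ?k" using t(4) by (metis diff_Suc_1 last_conv_nth list.size(3) nat.distinct(1))
  then have "superseded \<Pi> pos ?k (Max M)"
    using v assms(2) by (simp add: trace_ok_def blocks_ok_def)
  then obtain j y m where y: "j \<le> ?k" "y \<in> \<Pi>" "(at (pos j), at m) \<in> grnd A y"
    "j < ?k \<and> Max M \<le> m \<or> Max M < m"
    unfolding superseded_def by blast
  have j: "j < ?k"
  proof (rule ccontr)
    assume "\<not> j < ?k"
    then have "m \<in> M" "Max M < m" using y by (auto simp: M_def)
    then show False using fin by (meson Max_ge not_le)
  qed
  then obtain us' u where us: "us = us' @ [u]" by (metis length_0_conv not_less0 rev_exhaust)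
  \<comment> \<open>Strictness matters because \<open>j\<close> may be the starting index of the
    removed clause itself.\<close>
  have "pos ?k < m" using word_clause_increasing[OF wx x(2)] y(4) by linarith
  then have "superseded \<Pi> pos (length us') (pos (Suc (length us')))"
    unfolding superseded_def using j us y by (intro exI[of _ j] bexI[of _ y] exI[of _ m]) auto
  then show ?thesis using that us by blast
qed

lemma config_ok_step:
  assumes "adcl A accel r c c'" "reasonable A accel cs c r" "config_ok c"
  shows "config_ok c'"
  using assms
proof (cases rule: adcl.cases)
  case (adcl_init \<Phi>)
  then show ?thesis
    using assms(3) finite_problem word_clause_word_rule by (auto simp: clauses_ok_def problem_def)
next
  case (adcl_step \<psi> \<Pi> \<phi>s Bs L)
  have ok: "clauses_ok \<Pi>" using assms(3) adcl_step by simp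
  show ?thesis
  proof (cases "\<phi>s = []")
    case True
    then have "is_fact \<psi> \<or> is_cond_empty \<psi>" using assms(2) adcl_step by simp
    then have "\<psi> = start"
      using adcl_step ok by (auto simp: sip_clauses clauses_ok_def word_clause_def is_fact_def is_cond_empty_def is_rule_def)
    moreover have "Bs = [{}]" using assms(3) adcl_step True by simp
    moreover have "trace_ok \<Pi> (\<lambda>_. 0) [] [{}]" by (simp add: trace_ok_def path_def blocks_ok_def)
    ultimately show ?thesis using adcl_step ok True by auto
  next
    case False
    then obtain us B Cs pos where "\<phi>s = start # us" "Bs = B # Cs" "trace_ok \<Pi> pos us Cs"
      using assms(3) adcl_step by auto
    then show ?thesis using step_ok[OF ok, of pos us Cs \<psi> B] adcl_step ok by auto
  qed
next
  case (adcl_accelerate vs Ds \<phi> \<Pi> \<phi>s Bs L)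
  have ok: "clauses_ok \<Pi>" using assms(3) adcl_accelerate by simp
  obtain us B Cs pos where t: "\<phi>s @ vs = start # us" "Bs @ Ds = B # Cs" "trace_ok \<Pi> pos us Cs"
    using assms(3) adcl_accelerate by auto
  \<comment> \<open>A suffix that contains the fact has a resolvent without body atom and is not
    recursive.\<close>
  have "\<phi>s \<noteq> []"
  proof
    assume "\<phi>s = []"
    have "vs = start # us" using t(1) \<open>\<phi>s = []\<close> by simp
    have "grnd A (res_seq vs) = {(None, at (pos (length us)))}"
      using trace_res_seq t(3) \<open>vs = start # us\<close> by (auto simp: trace_ok_def)
    then have "(None, at (pos (length us))) \<in> grnd A (res_seq vs)" by simp
    then have "body (res_seq vs) = None" by (auto simp: grnd_def)
    then show False using adcl_accelerate by (simp add: recursive_def)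
  qed
  then obtain us' where us: "\<phi>s = start # us'" "us = us' @ vs" using t(1) by (cases \<phi>s) auto
  have "length (Bs @ Ds) = Suc (Suc (length us' + length vs))" using t us by (simp add: trace_ok_def)
  then have "Bs \<noteq> []" using adcl_accelerate by auto
  then obtain Cs' where Cs: "Bs = B # Cs'" "Cs = Cs' @ Ds" using t(2) by (cases Bs) auto
  show ?thesis
    using accelerate_ok[OF ok, of pos us' vs Cs' Ds] t(3) us Cs adcl_accelerate by auto
next
  case (adcl_covered \<Pi> vs ws Bs L)
  have ok: "clauses_ok \<Pi>" using assms(3) adcl_covered by simp
  obtain us B Cs pos where t: "ws @ vs = start # us" "Bs = B # Cs" "trace_ok \<Pi> pos us Cs"
    using assms(3) adcl_covered by (auto simp: covered_def)
  obtain us' u where u: "us = us' @ [u]" "superseded \<Pi> pos (length us') (pos (Suc (length us')))"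
    using covered_superseded[OF ok t(3) _ t(1)[symmetric]] adcl_covered by blast
  show ?thesis
    using bt_ok[of \<Pi> pos us' u Cs B L] t u ok adcl_covered by simp
next
  case (adcl_backtrack \<Pi> \<phi>s \<phi> Bs L)
  have ok: "clauses_ok \<Pi>" using assms(3) adcl_backtrack by simp
  obtain us B Cs pos where t: "\<phi>s @ [\<phi>] = start # us" "Bs = B # Cs" "trace_ok \<Pi> pos us Cs"
    using assms(3) adcl_backtrack by auto
  have "\<forall>\<psi>\<in>sip A \<Pi>. is_rule \<psi> \<or> is_query \<psi> \<longrightarrow> \<not> active A (start # us) (B # Cs) \<psi>"
    using adcl_backtrack t by simp
  then obtain us' u where u: "us = us' @ [u]" "superseded \<Pi> pos (length us') (pos (Suc (length us')))"
    by (rule backtrack_superseded[OF ok t(3)])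
  show ?thesis
    using bt_ok[of \<Pi> pos us' u Cs B L] t u ok adcl_backtrack by simp
next
  case (adcl_refutation \<phi>s \<Pi> Bs L)
  then show ?thesis by simp
next
  case (adcl_prove \<Pi> B L)
  \<comment> \<open>\<open>Prove\<close> needs an empty trace, where the invariant keeps the fact
    active.\<close>
  then show ?thesis using assms(3) start_active start_in_sip by (auto simp: is_fact_def start_def)
qed

section \<open>Progress and the infinite derivation\<close>

definition running :: "(nat, nat, nat, nat) config \<Rightarrow> bool" where
  "running c \<longleftrightarrow> config_ok c \<and> c \<noteq> Unsat"

text \<open>The cases follow the priorities of a reasonable strategy: an enforced
  \<open>Covered\<close>, the shortest acceleration, a step, and backtracking when nothing is
  active. The invariant is then inherited from \<open>config_ok_step\<close>.\<close>

lemma progress: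
  assumes "running c"
  shows "\<exists>r c'. adcl A accel r c c' \<and> reasonable A accel cs c r \<and> running c'"
proof -
  have ok: "config_ok c" using assms by (simp add: running_def)
  have "\<exists>r c'. adcl A accel r c c' \<and> reasonable A accel cs c r \<and> c' \<noteq> Unsat"
  proof (cases c)
    case (Start \<Phi>)
    then show ?thesis using adcl_init[of A accel \<Phi>] by (intro exI conjI) auto
  next
    case (State \<Pi> \<phi>s Bs L)
    have cl: "clauses_ok \<Pi>" using ok State by simp
    let ?enforced = "\<exists>\<psi>s \<psi>s' Bs' L'. \<phi>s = \<psi>s @ \<psi>s' \<and> covered A \<Pi> \<psi>s' \<and> State \<Pi> \<psi>s Bs' L' \<in> set cs"
    show ?thesis
    proof (cases ?enforced)
      case True
      then obtain \<psi>s \<psi>s' where "\<phi>s = \<psi>s @ \<psi>s'" "covered A \<Pi> \<psi>s'" by blast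
      then have "adcl A accel Covered c (bt c)" using adcl_covered State by blast
      then show ?thesis using State by (intro exI[of _ Covered] exI[of _ "bt c"]) auto
    next
      case not_enforced: False
      show ?thesis
      proof (cases "\<phi>s = []")
        case True
        then have "Bs = [{}]" using ok State by simp
        then have "adcl A accel (Step start) c (State \<Pi> [start] [{}, {}] L)"
          using adcl_step[OF start_in_sip[OF cl], of "[]" "[{}]" accel L] start_active State True by simp
        moreover have "reasonable A accel cs c (Step start)"
          using State True by (auto simp: accel_candidate_def covered_def is_fact_def start_def)
        ultimately show ?thesis by blast
      next
        case False
        then obtain us B Cs pos where t: "\<phi>s = start # us" "Bs = B # Cs" "trace_ok \<Pi> pos us Cs"
          using ok State by auto
        show ?thesis
        proof (cases "\<exists>vs. accel_candidate A accel \<Pi> \<phi>s vs")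
          case True
          then obtain vs where vs: "accel_candidate A accel \<Pi> \<phi>s vs"
            "\<And>vs'. accel_candidate A accel \<Pi> \<phi>s vs' \<Longrightarrow> length vs \<le> length vs'"
            using ex_has_least_nat[of "accel_candidate A accel \<Pi> \<phi>s" _ length] by blast
          then obtain ws where ws: "\<phi>s = ws @ vs" "vs \<noteq> []" "recursive (res_seq vs)"
            by (auto simp: accel_candidate_def suffix_def)
          \<comment> \<open>There is one blocking set more than there are trace elements, so the
            last \<open>length vs\<close> of them can be split off.\<close>
          define n where "n = length Bs - length vs"
          have "length Bs = Suc (length \<phi>s)" using t by (simp add: trace_ok_def)
          then have "length vs = length (drop n Bs)" using ws by (simp add: n_def)
          then have "\<exists>c'. adcl A accel (Accelerate vs) (State \<Pi> (ws @ vs) (take n Bs @ drop n Bs) L) c' \<and> c' \<noteq> Unsat"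
            using adcl_accelerate[OF ws(2,3)] by blast
          then have "\<exists>c'. adcl A accel (Accelerate vs) c c' \<and> c' \<noteq> Unsat" using State ws by simp
          moreover have "reasonable A accel cs c (Accelerate vs)"
            using State not_enforced vs by simp
          ultimately show ?thesis by blast
        next
          case no_candidate: False
          show ?thesis
          proof (cases "\<exists>\<psi>\<in>sip A \<Pi>. active A \<phi>s Bs \<psi>")
            case True
            then obtain \<psi> where "\<psi> \<in> sip A \<Pi>" "active A \<phi>s Bs \<psi>" by blast
            then have "adcl A accel (Step \<psi>) c (State \<Pi> (\<phi>s @ [\<psi>]) (Bs @ [{}]) L)"
              using adcl_step State by blast
            moreover have "reasonable A accel cs c (Step \<psi>)"
              using State not_enforced no_candidate False by simp
            ultimately show ?thesis by blast
          next
            case inactive: False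
            obtain \<psi>s \<psi> where \<psi>: "\<phi>s = \<psi>s @ [\<psi>]" using False by (metis rev_exhaust)
            have "\<psi> = start \<or> word_clause \<psi>"
            proof -
              have "\<psi> \<in> set (start # us)" using \<psi> t(1) by (metis in_set_conv_decomp)
              then show ?thesis using t(3) by (auto simp: trace_ok_def)
            qed
            then have "\<not> is_query \<psi>"
              by (auto simp: is_query_def start_def word_clause_def is_rule_def)
            then have "adcl A accel Backtrack c (bt c)"
              using adcl_backtrack[of A \<Pi> \<psi>s \<psi> Bs c L accel] inactive \<psi> State by blast
            moreover have "reasonable A accel cs c Backtrack"
              using State not_enforced by simp
            ultimately show ?thesis using State by (intro exI[of _ Backtrack] exI[of _ "bt c"]) auto
          qed
        qed
      qed
    qed
  qed (use assms in \<open>auto simp: running_def\<close>)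
  then show ?thesis using config_ok_step ok unfolding running_def by blast
qed

lemma never_sat: "\<nexists>cs. (adcl_rs A accel)\<^sup>*\<^sup>* [Start problem] (cs @ [Sat])"
proof
  assume "\<exists>cs. (adcl_rs A accel)\<^sup>*\<^sup>* [Start problem] (cs @ [Sat])"
  then obtain cs where "(adcl_rs A accel)\<^sup>*\<^sup>* [Start problem] (cs @ [Sat])" by blast
  then have "config_ok (last (cs @ [Sat]))"
  proof (induction rule: rtranclp_induct)
    case (step ds ds')
    from step.hyps(2) step.IH show ?case
      by (cases rule: adcl_rs.cases) (auto intro: config_ok_step)
  qed simp
  then show False by simp
qed

text \<open>Successors are chosen for whole derivations rather than configurations, because the
  strategy depends on the history; the chosen function is then iterated.\<close>

lemma infinite_derivation:
  "\<exists>D. D 0 = [Start problem] \<and> (\<forall>i. adcl_rs A accel (D i) (D (Suc i)))"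
proof -
  have "\<exists>ds'. (ds' \<noteq> [] \<and> running (last ds')) \<and> adcl_rs A accel ds ds'"
    if "ds \<noteq> [] \<and> running (last ds)" for ds
  proof -
    define cs c where "cs = butlast ds" "c = last ds"
    then have ds: "ds = cs @ [c]" "running c" using that by simp_all
    then obtain r c' where "adcl A accel r c c'" "reasonable A accel cs c r" "running c'"
      using progress by blast
    then show ?thesis
      using ds adcl_rs.intros[of A accel r c c' cs] by (intro exI[of _ "cs @ [c, c']"]) simp
  qed
  then obtain f where f: "\<And>ds. ds \<noteq> [] \<and> running (last ds) \<Longrightarrow>
      (f ds \<noteq> [] \<and> running (last (f ds))) \<and> adcl_rs A accel ds (f ds)"
    by metis
  define D where "D i = (f ^^ i) [Start problem]" for i
  have "D i \<noteq> [] \<and> running (last (D i))" for i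
    by (induction i) (use f in \<open>auto simp: D_def running_def\<close>)
  then have "adcl_rs A accel (D i) (D (Suc i))" for i
    using f[of "D i"] by (simp add: D_def)
  moreover have "D 0 = [Start problem]" by (simp add: D_def)
  ultimately show ?thesis by blast
qed

end

theorem theorem18:
  "\<exists>(A :: (nat, nat, nat) background) (Sig :: nat \<Rightarrow> nat list option) \<Phi>.
     is_background A \<and> finite \<Phi> \<and> (\<forall>\<phi>\<in>\<Phi>. is_chc A Sig \<phi>) \<and> chc_satisfiable A \<Phi> \<and>
     (\<exists>A' accel. is_background A' \<and> richer A' A \<and> acceleration_technique A' Sig accel) \<and>
     (\<forall>A' accel. is_background A' \<and> richer A' A \<and> acceleration_technique A' Sig accel \<longrightarrow>
        (\<nexists>cs. (adcl_rs A' accel)\<^sup>*\<^sup>* [Start \<Phi>] (cs @ [Sat])) \<and>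
        (\<exists>D. D 0 = [Start \<Phi>] \<and> (\<forall>i. adcl_rs A' accel (D i) (D (Suc i)))))"
proof (rule exI[of _ word_theory], rule exI[of _ pred_sig], rule exI[of _ problem], intro conjI)
  note ctx = is_background_word_theory richer_refl[of word_theory]
  show "\<forall>\<phi>\<in>problem. is_chc word_theory pred_sig \<phi>"
    using is_chc_start[OF ctx] is_chc_word_rule[OF ctx] by (auto simp: problem_def)
  show "chc_satisfiable word_theory problem"
    unfolding chc_satisfiable_def
    by (intro exI[of _ "\<lambda>_ _. True"])
      (auto simp: problem_def chc_holds_def patom_holds_def start_def word_rule_def)
  show "\<exists>A' accel. is_background A' \<and> richer A' word_theory \<and> acceleration_technique A' pred_sig accel"
    using acceleration_exists ctx by blast
  show "\<forall>A' accel. is_background A' \<and> richer A' word_theory \<and> acceleration_technique A' pred_sig accel \<longrightarrow>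
      (\<nexists>cs. (adcl_rs A' accel)\<^sup>*\<^sup>* [Start problem] (cs @ [Sat])) \<and>
      (\<exists>D. D 0 = [Start problem] \<and> (\<forall>i. adcl_rs A' accel (D i) (D (Suc i))))"
    using never_sat infinite_derivation by blast
qed (fact is_background_word_theory finite_problem)+

end
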